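(* Let $m>n\ge 1$ be integers, let $A=(a_{ij})$ be an $m\times n$ matrix of variables and $x=(x_1,\dots,x_n)^\top$ a column vector of variables, all $a_{ij}$ and $x_j$ being jointly algebraically independent over $\mathbb{R}$. Let $\mathscr{E}=\mathbb{R}(A,x)$ be the field of rational functions in all these variables, and let $\mathscr{F}_{n+1}=\mathbb{R}(A,p_1(Ax),\dots,p_{n+1}(Ax))$ be the subfield of $\mathscr{E}$ generated over $\mathbb{R}$ by the $a_{ij}$ and $p_1(Ax),\dots,p_{n+1}(Ax)$. Then $\mathscr{F}_{n+1}=\mathscr{E}$.
   Context: For each positive integer $\ell$, $p_\ell(Ax)=\sum_{i=1}^m\big(\sum_{j=1}^n a_{ij}x_j\big)^\ell$ is the $\ell$-th power sum $p_\ell=\sum_{i=1}^m y_i^\ell$ evaluated at the entries of $Ax$. *)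

theory Defs
  imports
    "HOL-Library.Poly_Mapping"
    "HOL-Library.Countable"
    "HOL-Computational_Algebra.Fraction_Field"
    "HOL-Algebra.Generated_Fields"
    "HOL-Algebra.Algebraic_Closure_Type"
begin

text \<open>
  The ambient field is the fraction field of the polynomial ring over the reals in the
  (infinitely many) variables \<open>a\<^sub>i\<^sub>j\<close>, \<open>x\<^sub>j\<close> with natural number indices. For given \<open>m\<close> and \<open>n\<close>
  only the variables with \<open>1 \<le> i \<le> m\<close> and \<open>1 \<le> j \<le> n\<close> are used.
\<close>

datatype var = MatVar nat nat | VecVar nat

instance var :: countable
  by countable_datatype

text \<open>
  The order on variables has no mathematical meaning; the library's proof that the polynomial
  ring is an integral domain needs some linear order.
\<close>

instantiation var :: linorder
begin

definition less_eq_var :: "var \<Rightarrow> var \<Rightarrow> bool" where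
  "(v::var) \<le> w \<longleftrightarrow> to_nat v \<le> to_nat w"

definition less_var :: "var \<Rightarrow> var \<Rightarrow> bool" where
  "(v::var) < w \<longleftrightarrow> to_nat v < to_nat w"

instance
  by standard (auto simp: less_eq_var_def less_var_def)

end

type_synonym real_mpoly = "(var \<Rightarrow>\<^sub>0 nat) \<Rightarrow>\<^sub>0 real"

type_synonym ratfun = "real_mpoly fract"

definition const :: "real \<Rightarrow> ratfun" where
  "const c = Fract (Poly_Mapping.single 0 c) 1"

definition Var :: "var \<Rightarrow> ratfun" where
  "Var v = Fract (Poly_Mapping.single (Poly_Mapping.single v 1) 1) 1"

text \<open>
  \<open>real_adjoin S\<close> is \<open>\<real>(S)\<close>. The record \<open>ring_of_type_algebra\<close> presents the type class field
  \<^typ>\<open>ratfun\<close> (with carrier \<open>UNIV\<close>) to HOL-Algebra.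
\<close>

definition real_adjoin :: "ratfun set \<Rightarrow> ratfun set" where
  "real_adjoin S = generate_field ring_of_type_algebra (range const \<union> S)"

definition matrix_vars :: "nat \<Rightarrow> nat \<Rightarrow> ratfun set" where
  "matrix_vars m n = {Var (MatVar i j) | i j. i \<in> {1..m} \<and> j \<in> {1..n}}"

definition vector_vars :: "nat \<Rightarrow> ratfun set" where
  "vector_vars n = {Var (VecVar j) | j. j \<in> {1..n}}"

definition power_sum_Ax :: "nat \<Rightarrow> nat \<Rightarrow> nat \<Rightarrow> ratfun" where
  "power_sum_Ax m n l = (\<Sum>i=1..m. (\<Sum>j=1..n. Var (MatVar i j) * Var (VecVar j)) ^ l)"

text \<open>
  \<open>field_E m n\<close> is \<open>\<real>(A, x)\<close>, and \<open>field_F m n k\<close> is \<open>\<real>(A, p\<^sub>1(Ax), \<dots>, p\<^sub>k(Ax))\<close>.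
\<close>

definition field_E :: "nat \<Rightarrow> nat \<Rightarrow> ratfun set" where
  "field_E m n = real_adjoin (matrix_vars m n \<union> vector_vars n)"

definition field_F :: "nat \<Rightarrow> nat \<Rightarrow> nat \<Rightarrow> ratfun set" where
  "field_F m n k = real_adjoin (matrix_vars m n \<union> power_sum_Ax m n ` {1..k})"

end

theory Submission
  imports Defs "HOL-Combinatorics.Permutations"
begin

text \<open>
  Put \<open>K = \<real>(A)\<close> and let \<open>T\<close> be the \<open>K\<close>-algebra generated by \<open>p\<^sub>1(Ax), \<dots>, p\<^sub>n\<^sub>+\<^sub>1(Ax)\<close>. If
  some \<open>x\<^sub>j\<close> were not in the fraction field of \<open>T\<close>, then \<open>T + x\<^sub>j T\<close> would be a direct sum in
  \<open>K[x]\<close>. So it suffices that \<open>T\<close> contains, in degree at most \<open>d\<close>, more than about half as many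
  linearly independent elements as \<open>K[x]\<close>, for some large \<open>d\<close>.

  Linear independence can be checked after specialising \<open>A\<close> to a real matrix. Choose one for which
  \<open>Ax\<close> consists of the coordinates \<open>y\<^sub>0, \<dots>, y\<^sub>n\<close> of a point of the hyperplane \<open>L = 0\<close>,
  \<open>L(y) = y\<^sub>0 + 2 y\<^sub>1 + \<dots> + (n + 1) y\<^sub>n\<close>, followed by zeros. The coefficients of \<open>L\<close> are
  distinct with nonzero sum, so no nontrivial permutation of the coordinates preserves the hyperplane,
  and \<open>t = \<Prod>\<^sub>\<tau>\<^sub>\<noteq>\<^sub>1 L(y\<^sub>\<tau>)\<close> is nonzero on it. For every polynomial \<open>g\<close> the symmetrisation of \<open>t g\<close>
  agrees with \<open>t g\<close> on the hyperplane, because every other summand contains the factor \<open>L(y)\<close>. Being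
  symmetric, it is a polynomial in \<open>p\<^sub>1, \<dots>, p\<^sub>n\<^sub>+\<^sub>1\<close> of the same weight. Hence the specialised algebra
  contains \<open>t \<real>[x]\<close>, and its degree-\<open>d\<close> part is asymptotically as large as that of \<open>\<real>[x]\<close>.
\<close>

section \<open>Evaluation of real polynomials\<close>

definition monom_val :: "('v \<Rightarrow> real) \<Rightarrow> ('v \<Rightarrow>\<^sub>0 nat) \<Rightarrow> real" where
  "monom_val a \<mu> = (\<Prod>v\<in>Poly_Mapping.keys \<mu>. a v ^ Poly_Mapping.lookup \<mu> v)"

definition mpoly_val :: "('v \<Rightarrow> real) \<Rightarrow> (('v \<Rightarrow>\<^sub>0 nat) \<Rightarrow>\<^sub>0 real) \<Rightarrow> real" where
  "mpoly_val a f = (\<Sum>\<mu>\<in>Poly_Mapping.keys f. Poly_Mapping.lookup f \<mu> * monom_val a \<mu>)"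

lemma monom_val_superset:
  assumes "finite S" "Poly_Mapping.keys \<mu> \<subseteq> S"
  shows "monom_val a \<mu> = (\<Prod>v\<in>S. a v ^ Poly_Mapping.lookup \<mu> v)"
  unfolding monom_val_def using assms
  by (intro prod.mono_neutral_left) (auto simp: in_keys_iff)

lemma mpoly_val_superset:
  assumes "finite S" "Poly_Mapping.keys f \<subseteq> S"
  shows "mpoly_val a f = (\<Sum>\<mu>\<in>S. Poly_Mapping.lookup f \<mu> * monom_val a \<mu>)"
  unfolding mpoly_val_def using assms
  by (intro sum.mono_neutral_left) (auto simp: in_keys_iff)

lemma monom_val_add: "monom_val a (\<mu> + \<nu>) = monom_val a \<mu> * monom_val a \<nu>"
proof -
  let ?S = "Poly_Mapping.keys \<mu> \<union> Poly_Mapping.keys \<nu>"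
  have "Poly_Mapping.keys (\<mu> + \<nu>) \<subseteq> ?S"
    by (rule Poly_Mapping.keys_add)
  then show ?thesis
    by (simp add: monom_val_superset[of ?S] lookup_add power_add prod.distrib)
qed

lemma mpoly_val_zero [simp]: "mpoly_val a 0 = 0"
  by (simp add: mpoly_val_def)

lemma mpoly_val_single [simp]: "mpoly_val a (Poly_Mapping.single \<mu> c) = c * monom_val a \<mu>"
  by (simp add: mpoly_val_def)

lemma monom_val_zero [simp]: "monom_val a 0 = 1"
  by (simp add: monom_val_def)

lemma monom_val_single [simp]: "monom_val a (Poly_Mapping.single v k) = a v ^ k"
  by (simp add: monom_val_def)

lemma mpoly_val_add [simp]: "mpoly_val a (f + g) = mpoly_val a f + mpoly_val a g"
proof -
  let ?S = "Poly_Mapping.keys f \<union> Poly_Mapping.keys g"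
  have "Poly_Mapping.keys (f + g) \<subseteq> ?S"
    by (rule Poly_Mapping.keys_add)
  then show ?thesis
    by (simp add: mpoly_val_superset[of ?S] lookup_add ring_distribs sum.distrib)
qed

lemma mpoly_val_sum [simp]: "mpoly_val a (sum f I) = (\<Sum>i\<in>I. mpoly_val a (f i))"
  by (induction I rule: infinite_finite_induct) auto

lemma sum_monomials:
  fixes f :: "'a \<Rightarrow>\<^sub>0 'b::comm_monoid_add"
  shows "f = (\<Sum>\<mu>\<in>Poly_Mapping.keys f. Poly_Mapping.single \<mu> (Poly_Mapping.lookup f \<mu>))"
  by (rule poly_mapping_eqI)
     (simp add: lookup_sum lookup_single when_def sum.delta in_keys_iff)

lemma mpoly_val_mult [simp]: "mpoly_val a (f * g) = mpoly_val a f * mpoly_val a g"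
proof -
  have "f * g = (\<Sum>\<mu>\<in>Poly_Mapping.keys f. \<Sum>\<nu>\<in>Poly_Mapping.keys g.
      Poly_Mapping.single (\<mu> + \<nu>) (Poly_Mapping.lookup f \<mu> * Poly_Mapping.lookup g \<nu>))"
    by (subst sum_monomials[of f], subst sum_monomials[of g])
       (simp add: sum_product Poly_Mapping.mult_single)
  then have "mpoly_val a (f * g) = (\<Sum>\<mu>\<in>Poly_Mapping.keys f. \<Sum>\<nu>\<in>Poly_Mapping.keys g.
      (Poly_Mapping.lookup f \<mu> * monom_val a \<mu>) * (Poly_Mapping.lookup g \<nu> * monom_val a \<nu>))"
    by (simp add: monom_val_add mult_ac)
  then show ?thesis
    by (simp add: mpoly_val_def sum_product)
qed

lemma mpoly_val_one [simp]: "mpoly_val a 1 = 1"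
  using mpoly_val_single[of a 0 1] by (simp del: mpoly_val_single)

lemma mpoly_val_power [simp]: "mpoly_val a (f ^ k) = mpoly_val a f ^ k"
  by (induction k) auto

lemma mpoly_val_prod [simp]: "mpoly_val a (prod f I) = (\<Prod>i\<in>I. mpoly_val a (f i))"
  by (induction I rule: infinite_finite_induct) auto

text \<open>Substituting the linear polynomial \<open>[:a v, b v:]\<close> for each variable gives
  the witness. Specialisation along a line thereby becomes a question about univariate
  polynomials.\<close>

lemma mpoly_val_line:
  "\<exists>q :: real poly. \<forall>s. mpoly_val (\<lambda>v. a v + s * b v) f = poly q s"
proof (intro exI allI)
  fix s
  show "mpoly_val (\<lambda>v. a v + s * b v) f =
      poly (\<Sum>\<mu>\<in>Poly_Mapping.keys f. [:Poly_Mapping.lookup f \<mu>:] *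
        (\<Prod>v\<in>Poly_Mapping.keys \<mu>. [:a v, b v:] ^ Poly_Mapping.lookup \<mu> v)) s"
    by (simp add: mpoly_val_def monom_val_def poly_sum poly_prod)
qed

text \<open>Reduction modulo \<open>N\<close> recovers the lowest digit; induction treats the
  others.\<close>

lemma base_expansion_unique:
  fixes b c :: "nat \<Rightarrow> nat"
  assumes "\<And>i. i < k \<Longrightarrow> b i < N" "\<And>i. i < k \<Longrightarrow> c i < N"
    and "(\<Sum>i<k. b i * N ^ i) = (\<Sum>i<k. c i * N ^ i)" and "i < k"
  shows "b i = c i"
  using assms
proof (induction k arbitrary: b c i)
  case (Suc k)
  have split: "(\<Sum>i<Suc k. d i * N ^ i) = d 0 + N * (\<Sum>i<k. d (Suc i) * N ^ i)" for d :: "nat \<Rightarrow> nat"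
    unfolding sum.lessThan_Suc_shift by (simp add: sum_distrib_left mult_ac)
  have eq: "b 0 + N * (\<Sum>i<k. b (Suc i) * N ^ i) = c 0 + N * (\<Sum>i<k. c (Suc i) * N ^ i)"
    using Suc.prems(3) unfolding split .
  have lt: "b 0 < N" "c 0 < N" using Suc.prems by auto
  have "b 0 = c 0"
    using arg_cong[OF eq, of "\<lambda>x. x mod N"] lt by simp
  moreover have "(\<Sum>i<k. b (Suc i) * N ^ i) = (\<Sum>i<k. c (Suc i) * N ^ i)"
    using eq \<open>b 0 = c 0\<close> lt by auto
  then have "b (Suc j) = c (Suc j)" if "j < k" for j
    using Suc.IH[of "\<lambda>i. b (Suc i)" "\<lambda>i. c (Suc i)" j] Suc.prems that by auto
  ultimately show ?case
    using Suc.prems(4) by (cases i) auto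
qed simp

text \<open>
  Kronecker substitution: sending the variable with number \<open>i\<close> to \<open>s ^ (N ^ i)\<close> with \<open>N\<close> above all
  exponents keeps distinct monomials distinct.
\<close>

lemma mpoly_nonzero_val:
  fixes f :: "('v::countable \<Rightarrow>\<^sub>0 nat) \<Rightarrow>\<^sub>0 real"
  assumes "f \<noteq> 0"
  shows "\<exists>a. mpoly_val a f \<noteq> 0"
proof -
  define V where "V = (\<Union>\<mu>\<in>Poly_Mapping.keys f. Poly_Mapping.keys \<mu>)"
  \<comment> \<open>Sums serve as crude upper bounds: \<open>N\<close> exceeds every exponent in
    \<open>f\<close>, and \<open>k\<close> exceeds the code of every variable in
    \<open>V\<close>.\<close>
  define N where "N = Suc (\<Sum>\<mu>\<in>Poly_Mapping.keys f. \<Sum>v\<in>Poly_Mapping.keys \<mu>. Poly_Mapping.lookup \<mu> v)"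
  define k where "k = Suc (\<Sum>v\<in>V. to_nat v)"
  define e :: "('v \<Rightarrow>\<^sub>0 nat) \<Rightarrow> nat" where "e \<mu> = (\<Sum>v\<in>V. Poly_Mapping.lookup \<mu> v * N ^ to_nat v)" for \<mu>
  have fV: "finite V" by (simp add: V_def)
  have N: "Poly_Mapping.lookup \<mu> v < N" if "\<mu> \<in> Poly_Mapping.keys f" for \<mu> v
  proof (cases "v \<in> Poly_Mapping.keys \<mu>")
    case True
    have "Poly_Mapping.lookup \<mu> v \<le> (\<Sum>v\<in>Poly_Mapping.keys \<mu>. Poly_Mapping.lookup \<mu> v)"
      using True by (intro member_le_sum) auto
    also have "\<dots> \<le> (\<Sum>\<mu>\<in>Poly_Mapping.keys f. \<Sum>v\<in>Poly_Mapping.keys \<mu>. Poly_Mapping.lookup \<mu> v)"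
      using that by (intro member_le_sum) auto
    finally show ?thesis by (simp add: N_def)
  qed (simp add: N_def in_keys_iff)
  have k: "to_nat v < k" if "v \<in> V" for v
    using member_le_sum[OF that, of to_nat] fV by (simp add: k_def)
  \<comment> \<open>Numbers that are not codes of variables in \<open>V\<close> get the digit 0, so
    that \<open>e \<mu>\<close> becomes a full base-\<open>N\<close> expansion of length
    \<open>k\<close>.\<close>
  have e_digits: "e \<mu> = (\<Sum>i<k. (if i \<in> to_nat ` V then Poly_Mapping.lookup \<mu> (from_nat i) else 0) * N ^ i)" for \<mu>
  proof -
    have "e \<mu> = (\<Sum>i\<in>to_nat ` V. Poly_Mapping.lookup \<mu> (from_nat i) * N ^ i)"
      unfolding e_def by (subst sum.reindex) auto
    also have "\<dots> = (\<Sum>i<k. (if i \<in> to_nat ` V then Poly_Mapping.lookup \<mu> (from_nat i) else 0) * N ^ i)"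
      using k by (intro sum.mono_neutral_cong_left) auto
    finally show ?thesis .
  qed
  have inj: "\<mu> = \<nu>" if \<mu>: "\<mu> \<in> Poly_Mapping.keys f" and \<nu>: "\<nu> \<in> Poly_Mapping.keys f" and e: "e \<mu> = e \<nu>" for \<mu> \<nu>
  proof (rule poly_mapping_eqI)
    fix v
    show "Poly_Mapping.lookup \<mu> v = Poly_Mapping.lookup \<nu> v"
    proof (cases "v \<in> V")
      case True
      have "(if to_nat v \<in> to_nat ` V then Poly_Mapping.lookup \<mu> (from_nat (to_nat v)) else 0) =
            (if to_nat v \<in> to_nat ` V then Poly_Mapping.lookup \<nu> (from_nat (to_nat v)) else 0)"
        by (rule base_expansion_unique[where k = k and N = N and
              b = "\<lambda>i. if i \<in> to_nat ` V then Poly_Mapping.lookup \<mu> (from_nat i) else 0" and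
              c = "\<lambda>i. if i \<in> to_nat ` V then Poly_Mapping.lookup \<nu> (from_nat i) else 0"])
           (use N[OF \<mu>] N[OF \<nu>] e k[OF True] in \<open>auto simp: e_digits N_def\<close>)
      then show ?thesis using True by simp
    next
      case False
      then have "v \<notin> Poly_Mapping.keys \<mu>" "v \<notin> Poly_Mapping.keys \<nu>"
        using \<mu> \<nu> by (auto simp: V_def)
      then show ?thesis by (simp add: in_keys_iff)
    qed
  qed
  \<comment> \<open>The univariate polynomial that \<open>f\<close> becomes under the substitution.
    By \<open>inj\<close>, no two of its terms can cancel.\<close>
  define q :: "real poly" where "q = (\<Sum>\<mu>\<in>Poly_Mapping.keys f. Polynomial.monom (Poly_Mapping.lookup f \<mu>) (e \<mu>))"
  obtain \<nu> where \<nu>: "\<nu> \<in> Poly_Mapping.keys f"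
    using assms by (metis keys_eq_empty all_not_in_conv)
  have "Polynomial.coeff q (e \<nu>) = (\<Sum>\<mu>\<in>Poly_Mapping.keys f. if \<mu> = \<nu> then Poly_Mapping.lookup f \<mu> else 0)"
    unfolding q_def Polynomial.coeff_sum
    by (intro sum.cong) (use inj \<nu> in auto)
  also have "\<dots> \<noteq> 0"
    using \<nu> by (simp add: in_keys_iff)
  finally have "q \<noteq> 0" by auto
  then obtain s where s: "poly q s \<noteq> 0"
    using poly_all_0_iff_0 by blast
  have "mpoly_val (\<lambda>v. s ^ (N ^ to_nat v)) f = poly q s"
    unfolding mpoly_val_def q_def poly_sum Polynomial.poly_monom
  proof (intro sum.cong refl)
    fix \<mu> assume "\<mu> \<in> Poly_Mapping.keys f"
    then have "monom_val (\<lambda>v. s ^ (N ^ to_nat v)) \<mu> = s ^ e \<mu>"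
      using fV by (subst monom_val_superset[of V])
        (auto simp: V_def e_def power_sum power_mult[symmetric] mult_ac)
    then show "Poly_Mapping.lookup f \<mu> * monom_val (\<lambda>v. s ^ (N ^ to_nat v)) \<mu> = Poly_Mapping.lookup f \<mu> * s ^ e \<mu>"
      by simp
  qed
  then show ?thesis using s by metis
qed

section \<open>Symmetric polynomials in terms of power sums\<close>

text \<open>The indeterminate \<open>P l\<close> carries weight \<open>l\<close>.\<close>

inductive wpoly :: "nat set \<Rightarrow> nat \<Rightarrow> ((nat \<Rightarrow> real) \<Rightarrow> real) \<Rightarrow> bool" for V where
  wpoly_const: "wpoly V w (\<lambda>_. c)"
| wpoly_var: "l \<in> V \<Longrightarrow> l \<le> w \<Longrightarrow> wpoly V w (\<lambda>P. P l)"
| wpoly_add: "wpoly V w f \<Longrightarrow> wpoly V w g \<Longrightarrow> wpoly V w (\<lambda>P. f P + g P)"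
| wpoly_mult: "wpoly V w f \<Longrightarrow> wpoly V v g \<Longrightarrow> wpoly V (w + v) (\<lambda>P. f P * g P)"

text \<open>Constants are allowed at every weight, so the weight is an upper bound and a factor 1
  can absorb the excess.\<close>

lemma wpoly_mono:
  assumes "wpoly V w f" "w \<le> v"
  shows "wpoly V v f"
  using wpoly_mult[OF assms(1) wpoly_const[of V "v - w" 1]] assms(2) by simp

lemma wpoly_mult_le:
  assumes "wpoly V w f" "wpoly V v g" "w + v \<le> u"
  shows "wpoly V u (\<lambda>P. f P * g P)"
  using wpoly_mono[OF wpoly_mult[OF assms(1,2)] assms(3)] .

lemma wpoly_sum:
  assumes "\<And>i. i \<in> I \<Longrightarrow> wpoly V w (f i)"
  shows "wpoly V w (\<lambda>P. \<Sum>i\<in>I. f i P)"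
  using assms
  by (induction I rule: infinite_finite_induct) (auto intro: wpoly_const wpoly_add)

text \<open>Replacing each indeterminate by an expression of at most its own weight cannot raise the
  total weight. This later eliminates the power sums beyond \<open>card S\<close>.\<close>

lemma wpoly_compose:
  assumes "wpoly U w f" "\<And>l. l \<le> w \<Longrightarrow> wpoly V l (\<rho> l)"
  shows "wpoly V w (\<lambda>P. f (\<lambda>l. \<rho> l P))"
  using assms
proof (induction rule: wpoly.induct)
  case (wpoly_var l w)
  then show ?case by (auto intro: wpoly_mono)
qed (auto intro: wpoly.intros)

text \<open>The Cauchy product, for the product case of \<open>wpoly_shift\<close>. The inner
  condition discards out-of-range indices, so nothing is assumed about \<open>a\<close> and
  \<open>b\<close> there.\<close>

lemma sum_power_mult_sum_power:
  fixes y :: real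
  shows "(\<Sum>i\<le>w. y ^ i * a i) * (\<Sum>j\<le>v. y ^ j * b j) =
    (\<Sum>k\<le>w + v. y ^ k * (\<Sum>i\<le>w. if i \<le> k \<and> k - i \<le> v then a i * b (k - i) else 0))"
proof -
  have "(\<Sum>k\<le>w + v. y ^ k * (\<Sum>i\<le>w. if i \<le> k \<and> k - i \<le> v then a i * b (k - i) else 0)) =
      (\<Sum>i\<le>w. \<Sum>k\<le>w + v. if i \<le> k \<and> k - i \<le> v then y ^ k * (a i * b (k - i)) else 0)"
    by (simp add: sum_distrib_left if_distrib cong: if_cong) (rule sum.swap)
  also have "\<dots> = (\<Sum>i\<le>w. \<Sum>j\<le>v. y ^ (i + j) * (a i * b j))"
  proof (rule sum.cong[OF refl])
    fix i assume "i \<in> {..w}"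
    then have "(\<Sum>k\<le>w + v. if i \<le> k \<and> k - i \<le> v then y ^ k * (a i * b (k - i)) else 0) =
        (\<Sum>k\<in>(+) i ` {..v}. y ^ k * (a i * b (k - i)))"
      by (intro sum.mono_neutral_cong_right) (auto simp: atMost_atLeast0)
    then show "(\<Sum>k\<le>w + v. if i \<le> k \<and> k - i \<le> v then y ^ k * (a i * b (k - i)) else 0) =
        (\<Sum>j\<le>v. y ^ (i + j) * (a i * b j))"
      by (simp add: sum.reindex)
  qed
  also have "\<dots> = (\<Sum>i\<le>w. y ^ i * a i) * (\<Sum>j\<le>v. y ^ j * b j)"
    by (simp add: sum_product power_add mult_ac)
  finally show ?thesis by simp
qed

text \<open>Deleting one coordinate \<open>y\<close> changes the \<open>l\<close>-th power sum by \<open>y ^ l\<close>.\<close>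

lemma wpoly_shift:
  assumes "wpoly UNIV w f"
  shows "\<exists>g. (\<forall>k\<le>w. wpoly UNIV (w - k) (g k)) \<and>
    (\<forall>P y. f (\<lambda>l. P l - y ^ l) = (\<Sum>k\<le>w. y ^ k * g k P))"
  using assms
proof (induction rule: wpoly.induct)
  case (wpoly_const w c)
  show ?case
    by (rule exI[of _ "\<lambda>k P. if k = 0 then c else 0"])
       (auto intro: wpoly.wpoly_const simp: sum.delta if_distrib cong: if_cong)
next
  case (wpoly_var l w)
  have "wpoly UNIV (w - k) (\<lambda>P. (if k = 0 then P l else 0) + (if k = l then -1 else 0))" for k
    using wpoly_var by (cases "k = 0"; intro wpoly.wpoly_add) (auto intro: wpoly.wpoly_var wpoly.wpoly_const)
  moreover have "P l - y ^ l =
      (\<Sum>k\<le>w. y ^ k * ((if k = 0 then P l else 0) + (if k = l then -1 else 0)))" for P :: "nat \<Rightarrow> real" and y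
  proof -
    have "(\<Sum>k\<le>w. y ^ k * ((if k = 0 then P l else 0) + (if k = l then -1 else 0))) =
        (\<Sum>k\<le>w. (if k = 0 then P l else 0) + (if k = l then - (y ^ l) else 0))"
      by (intro sum.cong) auto
    then show ?thesis using wpoly_var by (simp add: sum.distrib)
  qed
  ultimately show ?case
    by (intro exI[of _ "\<lambda>k P. (if k = 0 then P l else 0) + (if k = l then -1 else 0)"]) auto
next
  case (wpoly_add w f1 f2)
  then obtain g h where
    "\<forall>k\<le>w. wpoly UNIV (w - k) (g k)" "\<forall>P y. f1 (\<lambda>l. P l - y ^ l) = (\<Sum>k\<le>w. y ^ k * g k P)"
    "\<forall>k\<le>w. wpoly UNIV (w - k) (h k)" "\<forall>P y. f2 (\<lambda>l. P l - y ^ l) = (\<Sum>k\<le>w. y ^ k * h k P)"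
    by blast
  then show ?case
    by (intro exI[of _ "\<lambda>k P. g k P + h k P"])
       (auto intro: wpoly.wpoly_add simp: distrib_left sum.distrib)
next
  case (wpoly_mult w f1 v f2)
  then obtain g h where
    g: "\<And>k. k \<le> w \<Longrightarrow> wpoly UNIV (w - k) (g k)" "\<forall>P y. f1 (\<lambda>l. P l - y ^ l) = (\<Sum>k\<le>w. y ^ k * g k P)" and
    h: "\<And>k. k \<le> v \<Longrightarrow> wpoly UNIV (v - k) (h k)" "\<forall>P y. f2 (\<lambda>l. P l - y ^ l) = (\<Sum>k\<le>v. y ^ k * h k P)"
    by blast
  have "wpoly UNIV (w + v - k) (\<lambda>P. if i \<le> k \<and> k - i \<le> v then g i P * h (k - i) P else 0)"
    if "i \<le> w" for i k
    using g(1)[OF that] h(1)[of "k - i"] that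
    by (cases "i \<le> k \<and> k - i \<le> v") (auto intro: wpoly_mult_le wpoly.wpoly_const)
  then show ?case
    using g(2) h(2)
    by (intro exI[of _ "\<lambda>k P. \<Sum>i\<le>w. if i \<le> k \<and> k - i \<le> v then g i P * h (k - i) P else 0"])
       (auto intro: wpoly_sum simp: sum_power_mult_sum_power)
qed

section \<open>Symmetrised monomials in terms of all power sums\<close>

definition psum :: "nat set \<Rightarrow> (nat \<Rightarrow> real) \<Rightarrow> nat \<Rightarrow> real" where
  "psum S y l = (\<Sum>i\<in>S. y i ^ l)"

text \<open>The transposition moves the value \<open>y b\<close> to the position \<open>a\<close>
  outside \<open>S\<close>; the positions in \<open>S\<close> carry all the remaining
  values.\<close>

lemma psum_transpose:
  assumes "finite S" "a \<notin> S" "b \<in> insert a S"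
  shows "psum S (y \<circ> transpose a b) l = psum (insert a S) y l - y b ^ l"
proof -
  have "transpose a b permutes insert a S"
    using assms(3) by (intro permutes_swap_id) auto
  then have "psum (insert a S) (y \<circ> transpose a b) l = psum (insert a S) y l"
    unfolding psum_def using sum.permute[of "transpose a b" "insert a S" "\<lambda>i. y i ^ l"]
    by (simp add: o_def)
  then show ?thesis
    using assms(1,2) by (simp add: psum_def)
qed

text \<open>Induction on \<open>S\<close>: the permutations of \<open>insert a S\<close> are sorted
  by the image \<open>b\<close> of \<open>a\<close>. What remains is a symmetrised monomial in the
  coordinates other than \<open>y b\<close>, and \<open>wpoly_shift\<close> expands it in powers of
  \<open>y b\<close>. Summing over \<open>b\<close> turns these powers into power sums.\<close>

lemma symmetrised_monomial_wpoly:
  assumes "finite S"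
  shows "\<exists>f. wpoly UNIV (\<Sum>i\<in>S. \<delta> i) f \<and>
    (\<forall>y. (\<Sum>q | q permutes S. \<Prod>i\<in>S. y (q i) ^ \<delta> i) = f (psum S y))"
  using assms
proof (induction S rule: finite_induct)
  case empty
  show ?case by (rule exI[of _ "\<lambda>_. 1"]) (simp add: wpoly_const)
next
  case (insert a S)
  let ?w = "\<Sum>i\<in>S. \<delta> i"
  obtain f where f: "wpoly UNIV ?w f"
    "\<And>y. (\<Sum>q | q permutes S. \<Prod>i\<in>S. y (q i) ^ \<delta> i) = f (psum S y)"
    using insert.IH by blast
  obtain g where g: "\<And>k. k \<le> ?w \<Longrightarrow> wpoly UNIV (?w - k) (g k)"
    "\<And>P y. f (\<lambda>l. P l - y ^ l) = (\<Sum>k\<le>?w. y ^ k * g k P)"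
    using wpoly_shift[OF f(1)] by blast
  have "(\<Sum>q | q permutes insert a S. \<Prod>i\<in>insert a S. y (q i) ^ \<delta> i) =
      (\<Sum>k\<le>?w. psum (insert a S) y (\<delta> a + k) * g k (psum (insert a S) y))" for y
  proof -
    let ?P = "psum (insert a S) y"
    have "(\<Sum>q | q permutes insert a S. \<Prod>i\<in>insert a S. y (q i) ^ \<delta> i) =
      (\<Sum>b\<in>insert a S. \<Sum>q | q permutes S. \<Prod>i\<in>insert a S. y ((transpose a b \<circ> q) i) ^ \<delta> i)"
      by (rule sum_over_permutations_insert[OF insert.hyps])
    also have "\<dots> = (\<Sum>b\<in>insert a S. y b ^ \<delta> a *
        (\<Sum>q | q permutes S. \<Prod>i\<in>S. (y \<circ> transpose a b) (q i) ^ \<delta> i))"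
    proof (rule sum.cong[OF refl])
      fix b
      have "(\<Prod>i\<in>insert a S. y ((transpose a b \<circ> q) i) ^ \<delta> i) =
          y b ^ \<delta> a * (\<Prod>i\<in>S. (y \<circ> transpose a b) (q i) ^ \<delta> i)" if "q permutes S" for q
        using insert.hyps permutes_not_in[OF that, of a] by simp
      then show "(\<Sum>q | q permutes S. \<Prod>i\<in>insert a S. y ((transpose a b \<circ> q) i) ^ \<delta> i) =
          y b ^ \<delta> a * (\<Sum>q | q permutes S. \<Prod>i\<in>S. (y \<circ> transpose a b) (q i) ^ \<delta> i)"
        by (simp add: sum_distrib_left)
    qed
    also have "\<dots> = (\<Sum>b\<in>insert a S. y b ^ \<delta> a * f (psum S (y \<circ> transpose a b)))"
      by (simp only: f(2))
    also have "\<dots> = (\<Sum>b\<in>insert a S. y b ^ \<delta> a * f (\<lambda>l. ?P l - y b ^ l))"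
    proof (rule sum.cong[OF refl])
      fix b assume "b \<in> insert a S"
      then have "psum S (y \<circ> transpose a b) = (\<lambda>l. ?P l - y b ^ l)"
        using psum_transpose[OF insert.hyps] by blast
      then show "y b ^ \<delta> a * f (psum S (y \<circ> transpose a b)) = y b ^ \<delta> a * f (\<lambda>l. ?P l - y b ^ l)"
        by simp
    qed
    also have "\<dots> = (\<Sum>b\<in>insert a S. \<Sum>k\<le>?w. y b ^ (\<delta> a + k) * g k ?P)"
      by (simp only: g(2) sum_distrib_left power_add mult.assoc)
    also have "\<dots> = (\<Sum>k\<le>?w. \<Sum>b\<in>insert a S. y b ^ (\<delta> a + k) * g k ?P)"
      by (rule sum.swap)
    finally show ?thesis
      by (simp only: sum_distrib_right[symmetric] psum_def[of _ _ "\<delta> a + _"])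
  qed
  moreover have "wpoly UNIV (\<delta> a + ?w) (\<lambda>P. \<Sum>k\<le>?w. P (\<delta> a + k) * g k P)"
  proof (rule wpoly_sum)
    fix k assume "k \<in> {..?w}"
    then show "wpoly UNIV (\<delta> a + ?w) (\<lambda>P. P (\<delta> a + k) * g k P)"
      by (intro wpoly_mult_le[OF wpoly_var[of "\<delta> a + k" UNIV "\<delta> a + k"] g(1)]) auto
  qed
  ultimately show ?case
    using insert.hyps by (intro exI[of _ "\<lambda>P. \<Sum>k\<le>?w. P (\<delta> a + k) * g k P"]) simp
qed

section \<open>Newton's identities and the first \<open>card S\<close> power sums\<close>

definition psum_expressible :: "nat set \<Rightarrow> nat \<Rightarrow> ((nat \<Rightarrow> real) \<Rightarrow> real) \<Rightarrow> bool" where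
  "psum_expressible S w F \<longleftrightarrow> (\<exists>f. wpoly {1..card S} w f \<and> (\<forall>y. F y = f (psum S y)))"

lemma psum_expressible_const: "psum_expressible S w (\<lambda>_. c)"
  unfolding psum_expressible_def by (auto intro: exI[of _ "\<lambda>_. c"] wpoly_const)

lemma psum_expressible_add:
  "psum_expressible S w F \<Longrightarrow> psum_expressible S w G \<Longrightarrow> psum_expressible S w (\<lambda>y. F y + G y)"
  unfolding psum_expressible_def by (metis (no_types, lifting) wpoly_add)

lemma psum_expressible_mult:
  assumes "psum_expressible S w F" "psum_expressible S v G" "w + v \<le> u"
  shows "psum_expressible S u (\<lambda>y. F y * G y)"
proof -
  obtain f g where "wpoly {1..card S} w f" "\<forall>y. F y = f (psum S y)"
    "wpoly {1..card S} v g" "\<forall>y. G y = g (psum S y)"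
    using assms unfolding psum_expressible_def by blast
  then show ?thesis unfolding psum_expressible_def
    by (intro exI[of _ "\<lambda>P. f P * g P"]) (auto intro: wpoly_mult_le[OF _ _ assms(3)])
qed

lemma psum_expressible_cmult:
  "psum_expressible S w F \<Longrightarrow> psum_expressible S w (\<lambda>y. c * F y)"
  by (rule psum_expressible_mult[OF psum_expressible_const[of S 0]]) auto

lemma psum_expressible_sum:
  assumes "\<And>i. i \<in> I \<Longrightarrow> psum_expressible S w (F i)"
  shows "psum_expressible S w (\<lambda>y. \<Sum>i\<in>I. F i y)"
  using assms
  by (induction I rule: infinite_finite_induct)
     (auto intro: psum_expressible_const psum_expressible_add)

lemma psum_expressible_mono:
  assumes "psum_expressible S w F" "w \<le> v"
  shows "psum_expressible S v F"
  using assms unfolding psum_expressible_def by (blast intro: wpoly_mono)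

text \<open>Elementary symmetric functions, read off from their generating polynomial. They are
  defined for all \<open>k\<close>, and vanishing beyond \<open>card S\<close> is a degree
  bound.\<close>

definition esym :: "nat set \<Rightarrow> (nat \<Rightarrow> real) \<Rightarrow> nat \<Rightarrow> real" where
  "esym S y k = Polynomial.coeff (\<Prod>j\<in>S. [:1, y j:]) k"

lemma esym_0 [simp]: "esym S y 0 = 1"
  by (simp add: esym_def poly_0_coeff_0[symmetric] poly_prod)

lemma esym_insert_Suc:
  assumes "finite S" "i \<notin> S"
  shows "esym (insert i S) y (Suc k) = esym S y (Suc k) + y i * esym S y k"
  using assms by (simp add: esym_def)

lemma esym_eq_0:
  assumes "finite S" "card S < k"
  shows "esym S y k = 0"
proof -
  have "Polynomial.degree (\<Prod>j\<in>S. [:1, y j:]) \<le> (\<Sum>j\<in>S. Polynomial.degree [:1, y j:])"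
    by (rule degree_prod_sum_le[OF assms(1), unfolded o_def])
  also have "\<dots> \<le> (\<Sum>j\<in>S. 1)"
    by (intro sum_mono) auto
  finally show ?thesis
    unfolding esym_def using assms(2) by (intro Polynomial.coeff_eq_0) auto
qed

text \<open>Dividing the generating polynomial by \<open>[:1, y i:]\<close> amounts to multiplying
  by a geometric series in \<open>- y i\<close>.\<close>

lemma esym_remove:
  assumes "finite S" "i \<in> S"
  shows "esym (S - {i}) y k = (\<Sum>j\<le>k. (- y i) ^ j * esym S y (k - j))"
proof (induction k)
  case (Suc k)
  have "esym (S - {i}) y (Suc k) = esym S y (Suc k) - y i * esym (S - {i}) y k"
    using esym_insert_Suc[of "S - {i}" i y k] assms by (simp add: insert_absorb)
  also have "\<dots> = (\<Sum>j\<le>Suc k. (- y i) ^ j * esym S y (Suc k - j))"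
    unfolding Suc.IH sum.atMost_Suc_shift by (simp add: sum_distrib_left sum_negf mult_ac)
  finally show ?case .
qed simp

text \<open>Common source of both forms of Newton's identities: for \<open>d = 1\<close> the left
  side is a multiple of \<open>esym S y (Suc k)\<close>, and for \<open>k = card S\<close> it
  vanishes.\<close>

lemma sum_power_esym_remove:
  assumes "finite S"
  shows "(\<Sum>i\<in>S. y i ^ d * esym (S - {i}) y k) =
    (\<Sum>j\<le>k. (-1) ^ j * psum S y (d + j) * esym S y (k - j))"
proof -
  have "(\<Sum>i\<in>S. y i ^ d * esym (S - {i}) y k) =
      (\<Sum>i\<in>S. \<Sum>j\<le>k. (-1) ^ j * y i ^ (d + j) * esym S y (k - j))"
    using assms
    by (intro sum.cong) (auto simp: esym_remove sum_distrib_left power_add power_minus[of "y _"] mult_ac)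
  also have "\<dots> = (\<Sum>j\<le>k. \<Sum>i\<in>S. (-1) ^ j * y i ^ (d + j) * esym S y (k - j))"
    by (rule sum.swap)
  finally show ?thesis
    by (simp add: psum_def sum_distrib_left sum_distrib_right)
qed

text \<open>Both sides are a coefficient of the derivative of the generating polynomial, the right
  one by the product rule.\<close>

lemma Suc_mult_esym:
  assumes "finite S"
  shows "real (Suc k) * esym S y (Suc k) = (\<Sum>i\<in>S. y i * esym (S - {i}) y k)"
proof -
  have "real (Suc k) * esym S y (Suc k) = Polynomial.coeff (pderiv (\<Prod>j\<in>S. [:1, y j:])) k"
    by (simp add: esym_def Polynomial.coeff_pderiv)
  also have "\<dots> = (\<Sum>i\<in>S. y i * esym (S - {i}) y k)"
    by (simp add: pderiv_prod Polynomial.coeff_sum esym_def pderiv_pCons mult.commute)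
  finally show ?thesis .
qed

lemma psum_expressible_psum_le_card:
  assumes "finite S" "l \<le> card S"
  shows "psum_expressible S l (\<lambda>y. psum S y l)"
proof (cases "l = 0")
  case True
  then show ?thesis using psum_expressible_const[of S l "real (card S)"] by (simp add: psum_def)
next
  case False
  then show ?thesis
    unfolding psum_expressible_def using assms(2)
    by (intro exI[of _ "\<lambda>P. P l"]) (auto intro: wpoly_var)
qed

text \<open>Newton's identity is solved for \<open>esym S y k\<close> by dividing by
  \<open>k\<close>; only smaller indices occur on the other side.\<close>

lemma psum_expressible_esym:
  assumes "finite S" "k \<le> card S"
  shows "psum_expressible S k (\<lambda>y. esym S y k)"
  using assms(2)
proof (induction k rule: less_induct)
  case (less k)
  show ?case
  proof (cases k)
    case 0
    then show ?thesis by (simp add: psum_expressible_const)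
  next
    case (Suc k')
    have "esym S y k = (1 / real k) * (\<Sum>j\<le>k'. (-1) ^ j * psum S y (1 + j) * esym S y (k' - j))" for y
      using Suc_mult_esym[OF assms(1), of k' y] sum_power_esym_remove[OF assms(1), of y 1 k']
      by (simp add: Suc field_simps)
    moreover have "psum_expressible S k
        (\<lambda>y. (1 / real k) * (\<Sum>j\<le>k'. (-1) ^ j * psum S y (1 + j) * esym S y (k' - j)))"
    proof (intro psum_expressible_cmult psum_expressible_sum)
      fix j assume "j \<in> {..k'}"
      then show "psum_expressible S k (\<lambda>y. (-1) ^ j * psum S y (1 + j) * esym S y (k' - j))"
        using less Suc assms(1)
        by (intro psum_expressible_mult[OF psum_expressible_cmult[OF psum_expressible_psum_le_card]
              less.IH]) auto
    qed
    ultimately show ?thesis by simp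
  qed
qed

text \<open>
  Beyond \<open>card S\<close>, Newton's identities hold with zero in place of the elementary symmetric functions
  of too many variables, which reduces the higher power sums to the lower ones.
\<close>

lemma psum_expressible_psum:
  assumes "finite S"
  shows "psum_expressible S l (\<lambda>y. psum S y l)"
proof (induction l rule: less_induct)
  case (less l)
  show ?case
  proof (cases "l \<le> card S")
    case True
    then show ?thesis by (rule psum_expressible_psum_le_card[OF assms])
  next
    case False
    \<comment> \<open>With this \<open>d\<close>, the term \<open>j = r\<close> of Newton's identity
      contains the power sum of index \<open>l\<close>, and the terms \<open>j < r\<close> only
      lower ones.\<close>
    define r d where "r = card S" and "d = l - r"
    have l: "l = d + r" "d > 0" using False by (auto simp: r_def d_def)
    have "psum S y l = (- ((-1) ^ r)) * (\<Sum>j<r. (-1) ^ j * psum S y (d + j) * esym S y (r - j))" for y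
    proof -
      have "(\<Sum>i\<in>S. y i ^ d * esym (S - {i}) y r) = 0"
      proof (intro sum.neutral ballI)
        fix i assume "i \<in> S"
        then have "card (S - {i}) < r"
          unfolding r_def using assms by (intro psubset_card_mono) auto
        then show "y i ^ d * esym (S - {i}) y r = 0"
          using esym_eq_0[of "S - {i}" r y] assms by simp
      qed
      then have "(\<Sum>j<r. (-1) ^ j * psum S y (d + j) * esym S y (r - j)) + (-1) ^ r * psum S y l = 0"
        unfolding sum_power_esym_remove[OF assms]
        by (simp add: lessThan_Suc_atMost[symmetric] l(1))
      then have "(-1) ^ r * (\<Sum>j<r. (-1) ^ j * psum S y (d + j) * esym S y (r - j)) +
          ((-1) ^ r * (-1) ^ r) * psum S y l = 0"
        by (metis (no_types, lifting) distrib_left mult.assoc mult_zero_right)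
      moreover have "(-1) ^ r * (-1) ^ r = (1 :: real)"
        by (simp add: power_add[symmetric])
      ultimately show ?thesis by simp
    qed
    moreover have "psum_expressible S l
        (\<lambda>y. (- ((-1) ^ r)) * (\<Sum>j<r. (-1) ^ j * psum S y (d + j) * esym S y (r - j)))"
    proof (intro psum_expressible_cmult psum_expressible_sum)
      fix j assume "j \<in> {..<r}"
      then show "psum_expressible S l (\<lambda>y. (-1) ^ j * psum S y (d + j) * esym S y (r - j))"
        using l assms r_def
        by (intro psum_expressible_mult[OF psum_expressible_cmult[OF less.IH]
              psum_expressible_esym]) auto
    qed
    ultimately show ?thesis by simp
  qed
qed

lemma psum_expressible_symmetrised_monomial:
  assumes "finite S"
  shows "psum_expressible S (\<Sum>i\<in>S. \<delta> i) (\<lambda>y. \<Sum>q | q permutes S. \<Prod>i\<in>S. y (q i) ^ \<delta> i)"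
proof -
  obtain f where f: "wpoly UNIV (\<Sum>i\<in>S. \<delta> i) f"
    "\<And>y. (\<Sum>q | q permutes S. \<Prod>i\<in>S. y (q i) ^ \<delta> i) = f (psum S y)"
    using symmetrised_monomial_wpoly[OF assms] by blast
  have "\<forall>l. \<exists>g. wpoly {1..card S} l g \<and> (\<forall>y. psum S y l = g (psum S y))"
    using psum_expressible_psum[OF assms] unfolding psum_expressible_def by blast
  then obtain \<rho> where \<rho>: "\<And>l. wpoly {1..card S} l (\<rho> l)" "\<And>l y. psum S y l = \<rho> l (psum S y)"
    by metis
  have "f (psum S y) = f (\<lambda>l. \<rho> l (psum S y))" for y
    using \<rho>(2) by (intro arg_cong[where f = f]) auto
  then show ?thesis
    unfolding psum_expressible_def f(2)
    using wpoly_compose[OF f(1) \<rho>(1)] by blast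
qed

section \<open>Polynomial functions and their symmetrisation on the hyperplane\<close>

inductive polyfun :: "nat set \<Rightarrow> nat \<Rightarrow> ((nat \<Rightarrow> real) \<Rightarrow> real) \<Rightarrow> bool" for S w where
  polyfun_monom: "(\<Sum>i\<in>S. \<delta> i) \<le> w \<Longrightarrow> polyfun S w (\<lambda>y. c * (\<Prod>i\<in>S. y i ^ \<delta> i))"
| polyfun_add: "polyfun S w g \<Longrightarrow> polyfun S w h \<Longrightarrow> polyfun S w (\<lambda>y. g y + h y)"

lemma polyfun_mult:
  assumes "polyfun S w g" "polyfun S v h"
  shows "polyfun S (w + v) (\<lambda>y. g y * h y)"
  using assms(1)
proof (induction rule: polyfun.induct)
  case (polyfun_monom \<delta> c)
  note \<delta> = polyfun_monom
  from assms(2) show ?case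
  proof (induction rule: polyfun.induct)
    case (polyfun_monom \<epsilon> d)
    have "polyfun S (w + v) (\<lambda>y. (c * d) * (\<Prod>i\<in>S. y i ^ (\<delta> i + \<epsilon> i)))"
      using \<delta> polyfun_monom by (intro polyfun.polyfun_monom) (simp add: sum.distrib)
    then show ?case by (simp add: power_add prod.distrib mult_ac)
  next
    case (polyfun_add g h)
    then show ?case by (simp add: distrib_left polyfun.polyfun_add)
  qed
next
  case (polyfun_add g h)
  then show ?case by (simp add: distrib_right polyfun.polyfun_add)
qed

lemma polyfun_const: "polyfun S w (\<lambda>_. c)"
  using polyfun_monom[of "\<lambda>_. 0" S w c] by simp

lemma polyfun_sum:
  assumes "\<And>i. i \<in> I \<Longrightarrow> polyfun S w (F i)"
  shows "polyfun S w (\<lambda>y. \<Sum>i\<in>I. F i y)"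
  using assms
  by (induction I rule: infinite_finite_induct) (auto intro: polyfun_const polyfun_add)

lemma polyfun_prod:
  assumes "finite I" "\<And>i. i \<in> I \<Longrightarrow> polyfun S w (F i)"
  shows "polyfun S (card I * w) (\<lambda>y. \<Prod>i\<in>I. F i y)"
  using assms
  by (induction I rule: finite_induct) (auto intro: polyfun_const polyfun_mult)

lemma polyfun_coordinate:
  assumes "finite S" "i \<in> S"
  shows "polyfun S 1 (\<lambda>y. c * y i)"
proof -
  have "(\<Prod>j\<in>S. y j ^ (if j = i then 1 else 0)) = y i" for y :: "nat \<Rightarrow> real"
    using assms by (simp add: if_distrib cong: if_cong)
  then show ?thesis
    using polyfun_monom[of "\<lambda>j. if j = i then 1 else 0" S 1 c] assms by simp
qed

lemma psum_expressible_symmetrised: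
  assumes "finite S" "polyfun S w h"
  shows "psum_expressible S w (\<lambda>y. \<Sum>q | q permutes S. h (y \<circ> q))"
  using assms(2)
proof (induction rule: polyfun.induct)
  case (polyfun_monom \<delta> c)
  then show ?case
    using psum_expressible_cmult[OF psum_expressible_mono[OF
          psum_expressible_symmetrised_monomial[OF assms(1)] polyfun_monom], of c]
    by (simp add: sum_distrib_left)
next
  case (polyfun_add g h)
  then show ?case by (simp add: sum.distrib psum_expressible_add)
qed

definition weighted_sum :: "nat \<Rightarrow> (nat \<Rightarrow> real) \<Rightarrow> real" where
  "weighted_sum n y = (\<Sum>i\<le>n. real (Suc i) * y i)"

text \<open>The identity is left out because its factor vanishes on the hyperplane. All factors
  being linear, the number of them bounds the degree.\<close>

definition conjugate_prod :: "nat \<Rightarrow> (nat \<Rightarrow> real) \<Rightarrow> real" where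
  "conjugate_prod n y = (\<Prod>\<tau>\<in>{\<tau>. \<tau> permutes {..n}} - {id}. weighted_sum n (y \<circ> \<tau>))"

text \<open>
  On the hyperplane \<open>weighted_sum n y = 0\<close>, only the identity contributes to the symmetrisation.
\<close>

lemma conjugate_prod_psum:
  "\<exists>f. wpoly {1..Suc n} ((\<Sum>i\<le>n. \<gamma> i) + card ({\<tau>. \<tau> permutes {..n}} - {id})) f \<and>
    (\<forall>y. weighted_sum n y = 0 \<longrightarrow> f (psum {..n} y) = conjugate_prod n y * (\<Prod>i\<le>n. y i ^ \<gamma> i))"
proof -
  let ?T = "{\<tau>. \<tau> permutes {..n}} - {id}"
  define h where "h y = conjugate_prod n y * (\<Prod>i\<le>n. y i ^ \<gamma> i)" for y
  have "polyfun {..n} (card ?T * 1) (conjugate_prod n)"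
    unfolding conjugate_prod_def weighted_sum_def
  proof (intro polyfun_prod polyfun_sum)
    fix \<tau> i assume "\<tau> \<in> ?T" "i \<in> {..n}"
    then show "polyfun {..n} 1 (\<lambda>y. real (Suc i) * (y \<circ> \<tau>) i)"
      using polyfun_coordinate[of "{..n}" "\<tau> i" "real (Suc i)"] permutes_in_image[of \<tau> "{..n}" i]
      by simp
  qed (simp add: finite_permutations)
  moreover have "polyfun {..n} (\<Sum>i\<le>n. \<gamma> i) (\<lambda>y. \<Prod>i\<le>n. y i ^ \<gamma> i)"
    using polyfun_monom[of \<gamma> "{..n}" "\<Sum>i\<le>n. \<gamma> i" 1] by simp
  ultimately have "polyfun {..n} (card ?T + (\<Sum>i\<le>n. \<gamma> i)) h"
    unfolding h_def using polyfun_mult by fastforce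
  from psum_expressible_symmetrised[OF _ this]
  obtain f where f: "wpoly {1..Suc n} (card ?T + (\<Sum>i\<le>n. \<gamma> i)) f"
    "\<And>y. (\<Sum>q | q permutes {..n}. h (y \<circ> q)) = f (psum {..n} y)"
    unfolding psum_expressible_def card_atMost by blast
  have "f (psum {..n} y) = h y" if y: "weighted_sum n y = 0" for y
  proof -
    have "h (y \<circ> q) = 0" if q: "q \<in> ?T" for q
    proof -
      \<comment> \<open>The factor of \<open>conjugate_prod n (y \<circ> q)\<close> belonging to the
        inverse of \<open>q\<close> is \<open>weighted_sum n y\<close>, which is zero.\<close>
      have "inv_into UNIV q \<in> ?T"
        using q permutes_inv[of q] permutes_inv_inv[of q] by (auto simp: inv_id)
      moreover have "weighted_sum n (y \<circ> q \<circ> inv_into UNIV q) = 0"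
        using q y permutes_inv_o(1)[of q "{..n}"] by (simp add: o_assoc[symmetric])
      ultimately show ?thesis
        unfolding h_def conjugate_prod_def using finite_permutations[of "{..n}"]
        by (auto intro!: prod_zero)
    qed
    then have "(\<Sum>q | q permutes {..n}. h (y \<circ> q)) = (\<Sum>q\<in>{id}. h (y \<circ> q))"
      by (intro sum.mono_neutral_right) (auto simp: finite_permutations permutes_id)
    then show ?thesis by (simp add: f(2))
  qed
  then show ?thesis
    using f(1) unfolding h_def by (auto simp: add.commute)
qed

section \<open>Linear algebra over the polynomials in the matrix entries\<close>

text \<open>Gaussian elimination that multiplies by the pivot instead of dividing by it, so that the
  coefficients stay in the subring \<open>R\<close>.\<close>

lemma fraction_free_dependency:
  fixes M :: "'i \<Rightarrow> 'j \<Rightarrow> 'a::idom"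
  assumes "finite J" "finite I" "card J < card I"
    and one: "1 \<in> R" and uminus: "\<And>a. a \<in> R \<Longrightarrow> - a \<in> R"
    and add: "\<And>a b. a \<in> R \<Longrightarrow> b \<in> R \<Longrightarrow> a + b \<in> R"
    and mult: "\<And>a b. a \<in> R \<Longrightarrow> b \<in> R \<Longrightarrow> a * b \<in> R"
    and M: "\<And>i j. i \<in> I \<Longrightarrow> j \<in> J \<Longrightarrow> M i j \<in> R"
  shows "\<exists>c. (\<forall>i\<in>I. c i \<in> R) \<and> (\<exists>i\<in>I. c i \<noteq> 0) \<and> (\<forall>j\<in>J. (\<Sum>i\<in>I. c i * M i j) = 0)"
  using assms(1-3) M
proof (induction J arbitrary: I M rule: finite_induct)
  case empty
  then have "I \<noteq> {}" by auto
  then show ?case using one by (intro exI[of _ "\<lambda>_. 1"]) auto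
next
  case (insert j J)
  have zero: "0 \<in> R" using add[OF one uminus[OF one]] by simp
  have sum: "sum f K \<in> R" if "\<And>i. i \<in> K \<Longrightarrow> f i \<in> R" for f and K :: "'i set"
    using that by (induction K rule: infinite_finite_induct) (auto intro: zero add)
  show ?case
  proof (cases "\<forall>i\<in>I. M i j = 0")
    case True
    obtain c where "\<forall>i\<in>I. c i \<in> R" "\<exists>i\<in>I. c i \<noteq> 0" "\<forall>j'\<in>J. (\<Sum>i\<in>I. c i * M i j') = 0"
      using insert.IH[OF insert.prems(1), of M] insert.prems(2,3) insert.hyps by auto
    then show ?thesis using True by (intro exI[of _ c]) auto
  next
    case False
    then obtain p where p: "p \<in> I" "M p j \<noteq> 0" by auto
    let ?I = "I - {p}"
    let ?M = "\<lambda>i j'. M p j * M i j' - M i j * M p j'"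
    have diff: "a - b \<in> R" if "a \<in> R" "b \<in> R" for a b
      using add[OF that(1) uminus[OF that(2)]] by simp
    have "card J < card ?I"
      using insert.prems p(1) insert.hyps by simp
    moreover have "?M i j' \<in> R" if "i \<in> ?I" "j' \<in> J" for i j'
      using insert.prems(3) that p(1) by (intro diff mult) auto
    moreover have "finite ?I" using insert.prems(1) by simp
    ultimately obtain c where c: "\<forall>i\<in>?I. c i \<in> R" "\<exists>i\<in>?I. c i \<noteq> 0"
      "\<forall>j'\<in>J. (\<Sum>i\<in>?I. c i * ?M i j') = 0"
      using insert.IH[of ?I ?M] by blast
    \<comment> \<open>The coefficient at the pivot row \<open>p\<close> is chosen to cancel column
      \<open>j\<close>. The others stay nontrivial since \<open>M p j\<close> is nonzero in a
      domain.\<close>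
    define c' where "c' i = (if i = p then - (\<Sum>i\<in>?I. c i * M i j) else M p j * c i)" for i
    have "(\<Sum>i\<in>I. c' i * M i j') = (\<Sum>i\<in>?I. c i * ?M i j')" for j'
    proof -
      have "(\<Sum>i\<in>I. c' i * M i j') = c' p * M p j' + (\<Sum>i\<in>?I. c' i * M i j')"
        using p(1) insert.prems(1) by (rule sum.remove[rotated])
      also have "(\<Sum>i\<in>?I. c' i * M i j') = (\<Sum>i\<in>?I. M p j * c i * M i j')"
        by (intro sum.cong) (auto simp: c'_def)
      also have "c' p * M p j' + \<dots> =
          (\<Sum>i\<in>?I. M p j * c i * M i j' - c i * M i j * M p j')"
        by (simp add: c'_def sum_distrib_right sum_subtractf)
      also have "\<dots> = (\<Sum>i\<in>?I. c i * ?M i j')"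
        by (intro sum.cong) (auto simp: algebra_simps)
      finally show ?thesis .
    qed
    moreover have "(\<Sum>i\<in>?I. c i * ?M i j') = 0" if "j' \<in> insert j J" for j'
      using c(3) that by (cases "j' = j") auto
    moreover have "\<forall>i\<in>I. c' i \<in> R"
      using c(1) p(1) insert.prems(3) by (auto simp: c'_def intro!: uminus sum mult)
    moreover have "\<exists>i\<in>I. c' i \<noteq> 0"
      using c(2) p(2) by (auto simp: c'_def intro!: bexI)
    ultimately show ?thesis by (intro exI[of _ c']) auto
  qed
qed

text \<open>Doubling at every step of length \<open>c\<close> would give \<open>N (k * c)\<close> at
  least \<open>2 ^ k\<close>, faster than any polynomial.\<close>

lemma polynomial_growth_not_doubling:
  fixes N :: "nat \<Rightarrow> nat"
  assumes "N 0 > 0" "\<And>d. N d \<le> (d + 1) ^ n"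
  shows "\<exists>d. N (d + c) < 2 * N d"
proof (rule ccontr)
  assume "\<not> ?thesis"
  then have dbl: "2 * N d \<le> N (d + c)" for d by (meson not_le)
  have pow: "2 ^ k \<le> N (k * c)" for k
  proof (induction k)
    case (Suc k)
    then show ?case using dbl[of "k * c"] by (simp add: add.commute)
  qed (use assms(1) in simp)
  \<comment> \<open>The contradiction comes at \<open>k = 2 ^ j\<close>: comparing exponents of 2
    leaves \<open>2 ^ j\<close> against \<open>(j + c + 1) * n\<close>. This \<open>i\<close> makes
    the latter at most \<open>i * (3 * n)\<close>, with both factors below
    \<open>2 ^ i\<close>.\<close>
  define i where "i = c + 1 + 3 * n"
  define j where "j = 2 * i"
  have "(j + c + 1) * n \<le> (3 * i) * n"
    by (intro mult_right_mono) (auto simp: i_def j_def)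
  also have "\<dots> = i * (3 * n)" by simp
  also have "\<dots> < 2 ^ i * 2 ^ i"
  proof (rule mult_strict_mono)
    show "i < 2 ^ i" by (rule less_exp)
    have "3 * n < i" by (simp add: i_def)
    also have "i < 2 ^ i" by (rule less_exp)
    finally show "3 * n < 2 ^ i" .
  qed auto
  finally have less: "(j + c + 1) * n < 2 ^ j"
    by (simp add: j_def power_add[symmetric] mult_2)
  have "(2 :: nat) ^ (2 ^ j) \<le> (2 ^ j * c + 1) ^ n"
    using pow[of "2 ^ j"] assms(2)[of "2 ^ j * c"] by linarith
  also have "\<dots> \<le> (2 ^ j * (c + 1)) ^ n"
    by (intro power_mono) auto
  also have "\<dots> \<le> (2 ^ j * 2 ^ (c + 1)) ^ n"
    by (intro power_mono mult_left_mono less_imp_le less_exp) auto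
  also have "\<dots> = 2 ^ ((j + c + 1) * n)"
    by (simp add: power_add power_mult power_mult_distrib)
  finally have "2 ^ j \<le> (j + c + 1) * n"
    by (simp only: power_increasing_iff one_less_numeral_iff semiring_norm)
  then show False using less by simp
qed

text \<open>As long as all \<open>q i\<close> vanish at 0, the factor \<open>[:0, 1:]\<close> is
  cancelled; this stops because the degree of the nonzero \<open>q i0\<close> drops.\<close>

lemma common_X_power_factor:
  fixes q :: "'i \<Rightarrow> real poly"
  assumes "i0 \<in> I" "q i0 \<noteq> 0"
  shows "\<exists>k q'. (\<forall>i\<in>I. q i = [:0, 1:] ^ k * q' i) \<and> (\<exists>i\<in>I. poly (q' i) 0 \<noteq> 0)"
  using assms(2)
proof (induction "Polynomial.degree (q i0)" arbitrary: q rule: less_induct)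
  case less
  show ?case
  proof (cases "\<exists>i\<in>I. poly (q i) 0 \<noteq> 0")
    case True
    then show ?thesis by (intro exI[of _ 0] exI[of _ q]) auto
  next
    case False
    then have "\<forall>i\<in>I. [:0, 1:] dvd q i"
      by (auto simp: poly_eq_0_iff_dvd)
    then obtain p where p: "\<forall>i\<in>I. q i = [:0, 1:] * p i"
      unfolding dvd_def by metis
    have "p i0 \<noteq> 0" using p assms(1) less.prems by auto
    moreover have "q i0 = [:0, 1:] * p i0" using p assms(1) by blast
    ultimately have "Polynomial.degree (p i0) < Polynomial.degree (q i0)"
      by (simp add: Polynomial.degree_mult_eq)
    then obtain k p' where "\<forall>i\<in>I. p i = [:0, 1:] ^ k * p' i" "\<exists>i\<in>I. poly (p' i) 0 \<noteq> 0"
      using less.hyps[of p] \<open>p i0 \<noteq> 0\<close> by blast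
    then show ?thesis
      using p by (intro exI[of _ "Suc k"] exI[of _ p']) (auto simp: mult.assoc)
  qed
qed

section \<open>Polynomials in the matrix entries and their specialisation\<close>

definition mvar :: "var \<Rightarrow> real_mpoly" where
  "mvar v = Poly_Mapping.single (Poly_Mapping.single v 1) 1"

definition mconst :: "real \<Rightarrow> real_mpoly" where
  "mconst c = Poly_Mapping.single 0 c"

lemma mpoly_val_mvar [simp]: "mpoly_val a (mvar v) = a v"
  by (simp add: mvar_def)

lemma mpoly_val_mconst [simp]: "mpoly_val a (mconst c) = c"
  by (simp add: mconst_def)

lemma mconst_1: "mconst 1 = 1"
  by (simp add: mconst_def)

text \<open>The ring of real polynomials in \<open>A\<close>. It stands in for the field of rational
  functions in \<open>A\<close>, so that linear relations remain inside the polynomial ring and can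
  be evaluated.\<close>

inductive_set mat_polys :: "nat \<Rightarrow> nat \<Rightarrow> real_mpoly set" for m n where
  mat_polys_const: "mconst c \<in> mat_polys m n"
| mat_polys_var: "i \<in> {1..m} \<Longrightarrow> j \<in> {1..n} \<Longrightarrow> mvar (MatVar i j) \<in> mat_polys m n"
| mat_polys_add: "f \<in> mat_polys m n \<Longrightarrow> g \<in> mat_polys m n \<Longrightarrow> f + g \<in> mat_polys m n"
| mat_polys_mult: "f \<in> mat_polys m n \<Longrightarrow> g \<in> mat_polys m n \<Longrightarrow> f * g \<in> mat_polys m n"

lemma mat_polys_1: "1 \<in> mat_polys m n"
  using mat_polys_const[of 1] by (simp add: mconst_1)

lemma mat_polys_0: "0 \<in> mat_polys m n"
  using mat_polys_const[of 0] by (simp add: mconst_def)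

lemma mat_polys_uminus:
  assumes "f \<in> mat_polys m n"
  shows "- f \<in> mat_polys m n"
proof -
  have "- f = mconst (- 1) * f"
    by (simp add: mconst_def single_uminus)
  then show ?thesis
    using mat_polys_mult[OF mat_polys_const assms] by metis
qed

definition point :: "(nat \<Rightarrow> nat \<Rightarrow> real) \<Rightarrow> (nat \<Rightarrow> real) \<Rightarrow> var \<Rightarrow> real" where
  "point A x = case_var A x"

lemma point_simps [simp]: "point A x (MatVar i j) = A i j" "point A x (VecVar j) = x j"
  by (simp_all add: point_def)

lemma mat_polys_val_cong:
  assumes "f \<in> mat_polys m n"
  shows "mpoly_val (point A x) f = mpoly_val (point A x') f"
  using assms by induction auto

text \<open>
  Specialising directly may annihilate all coefficients. Instead approach \<open>A0\<close> along a line on which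
  some coefficient does not vanish identically, and cancel the common power of the parameter first.
\<close>

lemma specialise_relation:
  assumes "finite I" "\<And>i. i \<in> I \<Longrightarrow> c i \<in> mat_polys m n" "(\<Sum>i\<in>I. c i * G i) = 0"
    and "i0 \<in> I" "c i0 \<noteq> 0"
  shows "\<exists>b. (\<exists>i\<in>I. b i \<noteq> 0) \<and> (\<forall>x. (\<Sum>i\<in>I. b i * mpoly_val (point A0 x) (G i)) = 0)"
proof -
  obtain a where a: "mpoly_val a (c i0) \<noteq> 0"
    using mpoly_nonzero_val[OF assms(5)] by blast
  define A1 x1 where "A1 i j = a (MatVar i j)" and "x1 j = a (VecVar j)" for i j
  have a_eq: "a = point A1 x1"
    by (rule ext) (simp add: point_def A1_def x1_def split: var.split)
  define A where "A s i j = A0 i j + s * (A1 i j - A0 i j)" for s i j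
  have A01: "A 0 = A0" "A 1 = A1" by (simp_all add: A_def fun_eq_iff)
  have line: "\<exists>q. \<forall>s. mpoly_val (point (A s) x) f = poly q s" for x f
  proof -
    have "point (A s) x = (\<lambda>v. point A0 x v + s * point (\<lambda>i j. A1 i j - A0 i j) (\<lambda>_. 0) v)" for s
      by (rule ext) (simp add: point_def A_def split: var.split)
    then show ?thesis by (simp only: mpoly_val_line)
  qed
  \<comment> \<open>The vector may be frozen at \<open>x1\<close> because the \<open>c i\<close>
    involve matrix variables only. Hence the coefficients found from \<open>q\<close> serve every
    \<open>x\<close>.\<close>
  have "\<forall>i. \<exists>q. \<forall>s. mpoly_val (point (A s) x1) (c i) = poly q s"
    using line by blast
  then obtain q where q: "\<And>i s. mpoly_val (point (A s) x1) (c i) = poly (q i) s"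
    unfolding choice_iff by blast
  have "poly (q i0) 1 \<noteq> 0"
    using a unfolding q[symmetric] A01 a_eq[symmetric] .
  then have "q i0 \<noteq> 0" by auto
  then obtain k q' where q': "\<And>i. i \<in> I \<Longrightarrow> q i = [:0, 1:] ^ k * q' i" "\<exists>i\<in>I. poly (q' i) 0 \<noteq> 0"
    using common_X_power_factor[OF assms(4)] by blast
  have "(\<Sum>i\<in>I. poly (q' i) 0 * mpoly_val (point A0 x) (G i)) = 0" for x
  proof -
    have "\<forall>i. \<exists>r. \<forall>s. mpoly_val (point (A s) x) (G i) = poly r s"
      using line by blast
    then obtain r where r: "\<And>i s. mpoly_val (point (A s) x) (G i) = poly (r i) s"
      unfolding choice_iff by blast
    \<comment> \<open>The relation holds for all \<open>s\<close>, hence as a polynomial identity;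
      the power of \<open>s\<close> can be cancelled before setting \<open>s = 0\<close>.\<close>
    have "poly ([:0, 1:] ^ k * (\<Sum>i\<in>I. q' i * r i)) s = 0" for s
    proof -
      have "poly ([:0, 1:] ^ k * (\<Sum>i\<in>I. q' i * r i)) s = (\<Sum>i\<in>I. poly (q i) s * poly (r i) s)"
      proof -
        have "(\<Sum>i\<in>I. poly (q i) s * poly (r i) s) = (\<Sum>i\<in>I. s ^ k * (poly (q' i) s * poly (r i) s))"
          by (intro sum.cong refl) (simp only: q'(1), simp)
        then show ?thesis by (simp add: poly_sum sum_distrib_left)
      qed
      also have "\<dots> = (\<Sum>i\<in>I. mpoly_val (point (A s) x) (c i) * mpoly_val (point (A s) x) (G i))"
      proof (intro sum.cong refl)
        fix i assume "i \<in> I"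
        then have "mpoly_val (point (A s) x) (c i) = mpoly_val (point (A s) x1) (c i)"
          by (intro mat_polys_val_cong[OF assms(2)])
        then show "poly (q i) s * poly (r i) s =
            mpoly_val (point (A s) x) (c i) * mpoly_val (point (A s) x) (G i)"
          by (simp add: q r)
      qed
      also have "\<dots> = mpoly_val (point (A s) x) (\<Sum>i\<in>I. c i * G i)" by simp
      finally show ?thesis by (simp add: assms(3))
    qed
    then have "[:0, 1:] ^ k * (\<Sum>i\<in>I. q' i * r i) = 0"
      by (intro poly_all_0_iff_0[THEN iffD1] allI)
    then have "poly (\<Sum>i\<in>I. q' i * r i) 0 = 0" by simp
    then show ?thesis
      unfolding poly_sum poly_mult r[symmetric] A01 .
  qed
  then show ?thesis
    using q'(2) by (intro exI[of _ "\<lambda>i. poly (q' i) 0"]) auto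
qed

section \<open>Filtration by degree in the vector variables\<close>

definition vec_monoms :: "nat \<Rightarrow> nat \<Rightarrow> (var \<Rightarrow>\<^sub>0 nat) set" where
  "vec_monoms n d = {\<mu>. Poly_Mapping.keys \<mu> \<subseteq> VecVar ` {1..n} \<and>
    (\<Sum>j=1..n. Poly_Mapping.lookup \<mu> (VecVar j)) \<le> d}"

text \<open>Exponent vectors lie in a box of side \<open>d + 1\<close>. A crude bound is enough,
  since only polynomial growth in \<open>d\<close> matters.\<close>

lemma vec_monoms_finite_card: "finite (vec_monoms n d) \<and> card (vec_monoms n d) \<le> (d + 1) ^ n"
proof -
  let ?e = "\<lambda>\<mu>. restrict (\<lambda>j. Poly_Mapping.lookup \<mu> (VecVar j)) {1..n}"
  let ?B = "PiE {1..n} (\<lambda>_. {..d})"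
  have "inj_on ?e (vec_monoms n d)"
  proof (rule inj_onI, rule poly_mapping_eqI)
    fix \<mu> \<nu> v
    assume \<mu>: "\<mu> \<in> vec_monoms n d" and \<nu>: "\<nu> \<in> vec_monoms n d" and eq: "?e \<mu> = ?e \<nu>"
    show "Poly_Mapping.lookup \<mu> v = Poly_Mapping.lookup \<nu> v"
    proof (cases "v \<in> VecVar ` {1..n}")
      case True
      then obtain j where "j \<in> {1..n}" "v = VecVar j" by auto
      then show ?thesis using fun_cong[OF eq, of j] by simp
    next
      case False
      then have "v \<notin> Poly_Mapping.keys \<mu>" "v \<notin> Poly_Mapping.keys \<nu>"
        using \<mu> \<nu> unfolding vec_monoms_def by blast+
      then show ?thesis by (simp add: in_keys_iff)
    qed
  qed
  moreover have "?e ` vec_monoms n d \<subseteq> ?B"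
  proof clarify
    fix \<mu> assume \<mu>: "\<mu> \<in> vec_monoms n d"
    have "Poly_Mapping.lookup \<mu> (VecVar j) \<le> d" if "j \<in> {1..n}" for j
      using member_le_sum[OF that, of "\<lambda>j. Poly_Mapping.lookup \<mu> (VecVar j)"] \<mu>
      by (simp add: vec_monoms_def)
    then show "?e \<mu> \<in> ?B" by (intro restrict_PiE_iff[THEN iffD2]) auto
  qed
  moreover have fin: "finite ?B" by (intro finite_PiE) auto
  moreover have "card ?B = (d + 1) ^ n" by (simp add: card_PiE)
  ultimately show ?thesis
    using card_inj_on_le[of ?e "vec_monoms n d" ?B] inj_on_finite[of ?e "vec_monoms n d" ?B] by simp
qed

lemmas finite_vec_monoms [simp] = vec_monoms_finite_card[THEN conjunct1]
lemmas card_vec_monoms_le = vec_monoms_finite_card[THEN conjunct2]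

lemma zero_in_vec_monoms: "0 \<in> vec_monoms n d"
  by (simp add: vec_monoms_def)

lemma vec_monoms_add:
  assumes "\<mu> \<in> vec_monoms n d" "\<nu> \<in> vec_monoms n e"
  shows "\<mu> + \<nu> \<in> vec_monoms n (d + e)"
  using assms keys_add[of \<mu> \<nu>] unfolding vec_monoms_def
  by (auto simp: lookup_add sum.distrib)

text \<open>The module over \<open>mat_polys m n\<close> of polynomials of degree at most
  \<open>d\<close> in \<open>x\<close>.\<close>

inductive_set vec_span :: "nat \<Rightarrow> nat \<Rightarrow> nat \<Rightarrow> real_mpoly set" for m n d where
  vec_span_monom: "c \<in> mat_polys m n \<Longrightarrow> \<mu> \<in> vec_monoms n d \<Longrightarrow>
    c * Poly_Mapping.single \<mu> 1 \<in> vec_span m n d"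
| vec_span_add: "f \<in> vec_span m n d \<Longrightarrow> g \<in> vec_span m n d \<Longrightarrow> f + g \<in> vec_span m n d"

lemma vec_span_mult:
  assumes "f \<in> vec_span m n d" "g \<in> vec_span m n e"
  shows "f * g \<in> vec_span m n (d + e)"
  using assms(1)
proof induction
  case (vec_span_monom c \<mu>)
  note \<mu> = vec_span_monom
  from assms(2) show ?case
  proof induction
    case (vec_span_monom c' \<nu>)
    have "Poly_Mapping.single \<mu> 1 * Poly_Mapping.single \<nu> 1 = Poly_Mapping.single (\<mu> + \<nu>) (1 :: real)"
      by (simp add: mult_single)
    moreover have "c * Poly_Mapping.single \<mu> 1 * (c' * Poly_Mapping.single \<nu> 1) =
        (c * c') * (Poly_Mapping.single \<mu> 1 * Poly_Mapping.single \<nu> 1)"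
      by (simp only: mult_ac)
    ultimately have "c * Poly_Mapping.single \<mu> 1 * (c' * Poly_Mapping.single \<nu> 1) =
        (c * c') * Poly_Mapping.single (\<mu> + \<nu>) 1"
      by simp
    then show ?case
      using vec_span.vec_span_monom[OF mat_polys_mult[OF \<mu>(1) vec_span_monom(1)]
          vec_monoms_add[OF \<mu>(2) vec_span_monom(2)]] by metis
  next
    case (vec_span_add f g)
    then show ?case by (simp add: distrib_left vec_span.vec_span_add)
  qed
next
  case (vec_span_add f g)
  then show ?case by (simp add: distrib_right vec_span.vec_span_add)
qed

lemma vec_span_mat_polys: "c \<in> mat_polys m n \<Longrightarrow> c \<in> vec_span m n d"
  using vec_span_monom[OF _ zero_in_vec_monoms, of c m n d] by simp

lemma vec_span_VecVar:
  assumes "j \<in> {1..n}"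
  shows "mvar (VecVar j) \<in> vec_span m n 1"
proof -
  have "Poly_Mapping.single (VecVar j) 1 \<in> vec_monoms n 1"
    using assms unfolding vec_monoms_def
    by (auto simp: lookup_single when_def sum.delta)
  then show ?thesis
    using vec_span_monom[OF mat_polys_1] by (fastforce simp: mvar_def)
qed

lemma vec_span_sum:
  assumes "\<And>i. i \<in> I \<Longrightarrow> f i \<in> vec_span m n d"
  shows "sum f I \<in> vec_span m n d"
  using assms
  by (induction I rule: infinite_finite_induct)
     (auto intro: vec_span_add vec_span_mat_polys mat_polys_0)

lemma vec_span_power: "f \<in> vec_span m n 1 \<Longrightarrow> f ^ l \<in> vec_span m n l"
proof (induction l)
  case (Suc l)
  then show ?case using vec_span_mult[of f m n 1 "f ^ l" l] by simp
qed (simp add: vec_span_mat_polys mat_polys_1)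

lemma vec_span_mono:
  assumes "f \<in> vec_span m n d" "d \<le> e"
  shows "f \<in> vec_span m n e"
  using vec_span_mult[OF assms(1) vec_span_mat_polys[OF mat_polys_1, where d = "e - d"]] assms(2)
  by simp

lemma vec_span_coefficients:
  assumes "f \<in> vec_span m n d"
  shows "\<exists>Q. (\<forall>\<mu>. Q \<mu> \<in> mat_polys m n) \<and>
    f = (\<Sum>\<mu>\<in>vec_monoms n d. Q \<mu> * Poly_Mapping.single \<mu> 1)"
  using assms
proof induction
  case (vec_span_monom c \<mu>)
  then show ?case
    by (intro exI[of _ "\<lambda>\<nu>. if \<nu> = \<mu> then c else 0"])
       (auto simp: mat_polys_0 sum.delta if_distrib[of "\<lambda>x. x * _"] cong: if_cong)
next
  case (vec_span_add f g)
  then obtain P Q where "\<forall>\<mu>. P \<mu> \<in> mat_polys m n" "\<forall>\<mu>. Q \<mu> \<in> mat_polys m n"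
    "f = (\<Sum>\<mu>\<in>vec_monoms n d. P \<mu> * Poly_Mapping.single \<mu> 1)"
    "g = (\<Sum>\<mu>\<in>vec_monoms n d. Q \<mu> * Poly_Mapping.single \<mu> 1)" by blast
  then show ?case
    by (intro exI[of _ "\<lambda>\<mu>. P \<mu> + Q \<mu>"]) (auto simp: mat_polys_add distrib_right sum.distrib)
qed

section \<open>The subfields of the field of rational functions\<close>

lemma ring_of_type_algebra_ops:
  fixes a b :: "'a::field"
  shows "a \<oplus>\<^bsub>ring_of_type_algebra\<^esub> b = a + b"
    and "a \<otimes>\<^bsub>ring_of_type_algebra\<^esub> b = a * b"
    and "\<one>\<^bsub>ring_of_type_algebra\<^esub> = (1 :: 'a)"
    and "\<zero>\<^bsub>ring_of_type_algebra\<^esub> = (0 :: 'a)"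
    and "\<ominus>\<^bsub>ring_of_type_algebra\<^esub> a = - a"
    and "a \<noteq> 0 \<Longrightarrow> inv\<^bsub>ring_of_type_algebra\<^esub> a = inverse a"
proof -
  interpret R: Ring.field "ring_of_type_algebra :: 'a ring"
    by (rule field_from_type_algebra)
  show "a \<oplus>\<^bsub>ring_of_type_algebra\<^esub> b = a + b" "a \<otimes>\<^bsub>ring_of_type_algebra\<^esub> b = a * b"
    "\<one>\<^bsub>ring_of_type_algebra\<^esub> = (1 :: 'a)" "\<zero>\<^bsub>ring_of_type_algebra\<^esub> = (0 :: 'a)"
    by (simp_all add: ring_of_type_algebra_def)
  show "\<ominus>\<^bsub>ring_of_type_algebra\<^esub> a = - a"
    by (rule R.minus_equality) (simp_all add: ring_of_type_algebra_def)
  show "inv\<^bsub>ring_of_type_algebra\<^esub> a = inverse a" if "a \<noteq> 0"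
    using that by (intro R.comm_inv_char) (simp_all add: ring_of_type_algebra_def)
qed

lemma real_adjoin_const: "const c \<in> real_adjoin S"
  unfolding real_adjoin_def by (rule generate_field.incl) auto

lemma real_adjoin_incl: "f \<in> S \<Longrightarrow> f \<in> real_adjoin S"
  unfolding real_adjoin_def by (rule generate_field.incl) auto

lemma real_adjoin_1: "1 \<in> real_adjoin S"
  unfolding real_adjoin_def
  using generate_field.one[of ring_of_type_algebra "range const \<union> S"]
  by (simp only: ring_of_type_algebra_ops)

lemma real_adjoin_add: "f \<in> real_adjoin S \<Longrightarrow> g \<in> real_adjoin S \<Longrightarrow> f + g \<in> real_adjoin S"
  unfolding real_adjoin_def
  using generate_field.eng_add[of f ring_of_type_algebra "range const \<union> S" g]
  by (simp only: ring_of_type_algebra_ops)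

lemma real_adjoin_mult: "f \<in> real_adjoin S \<Longrightarrow> g \<in> real_adjoin S \<Longrightarrow> f * g \<in> real_adjoin S"
  unfolding real_adjoin_def
  using generate_field.eng_mult[of f ring_of_type_algebra "range const \<union> S" g]
  by (simp only: ring_of_type_algebra_ops)

lemma real_adjoin_uminus: "f \<in> real_adjoin S \<Longrightarrow> - f \<in> real_adjoin S"
  unfolding real_adjoin_def
  using generate_field.a_inv[of f ring_of_type_algebra "range const \<union> S"]
  by (simp only: ring_of_type_algebra_ops)

lemma real_adjoin_inverse:
  assumes "f \<in> real_adjoin S"
  shows "inverse f \<in> real_adjoin S"
\<comment> \<open>\<open>generate_field\<close> inverts nonzero elements only, whereas the type
  class has \<open>inverse 0 = 0\<close>.\<close>
proof (cases "f = 0")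
  case False
  then show ?thesis
    using generate_field.m_inv[of f ring_of_type_algebra "range const \<union> S"] assms
    by (simp add: real_adjoin_def ring_of_type_algebra_ops)
qed (use assms in simp)

lemma real_adjoin_0: "0 \<in> real_adjoin S"
  using real_adjoin_add[OF real_adjoin_1 real_adjoin_uminus[OF real_adjoin_1]] by simp

lemma real_adjoin_sum: "(\<And>i. i \<in> I \<Longrightarrow> f i \<in> real_adjoin S) \<Longrightarrow> sum f I \<in> real_adjoin S"
  by (induction I rule: infinite_finite_induct) (auto intro: real_adjoin_0 real_adjoin_add)

lemma real_adjoin_power: "f \<in> real_adjoin S \<Longrightarrow> f ^ k \<in> real_adjoin S"
  by (induction k) (auto intro: real_adjoin_1 real_adjoin_mult)

lemma real_adjoin_subset:
  assumes "S \<subseteq> real_adjoin T"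
  shows "real_adjoin S \<subseteq> real_adjoin T"
proof
  fix f assume "f \<in> real_adjoin S"
  then show "f \<in> real_adjoin T"
    unfolding real_adjoin_def[of S]
  proof (induction rule: generate_field.induct)
    case (incl h)
    then show ?case using assms real_adjoin_const by auto
  qed (use real_adjoin_1 real_adjoin_add real_adjoin_mult real_adjoin_uminus real_adjoin_inverse in
      \<open>simp_all add: ring_of_type_algebra_ops\<close>)
qed

definition embed :: "real_mpoly \<Rightarrow> ratfun" where
  "embed f = Fract f 1"

lemma embed_add: "embed (f + g) = embed f + embed g"
  by (simp add: embed_def)

lemma embed_mult: "embed (f * g) = embed f * embed g"
  by (simp add: embed_def)

lemma embed_0_iff: "embed f = 0 \<longleftrightarrow> f = 0"
  by (simp add: embed_def Zero_fract_def eq_fract)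

lemma embed_sum: "embed (sum f I) = (\<Sum>i\<in>I. embed (f i))"
  by (induction I rule: infinite_finite_induct) (simp_all add: embed_add embed_0_iff)

lemma embed_power: "embed (f ^ k) = embed f ^ k"
  by (induction k) (simp_all add: embed_mult, simp add: embed_def One_fract_def)

lemma embed_mvar: "embed (mvar v) = Var v"
  by (simp add: embed_def mvar_def Var_def)

lemma embed_mconst: "embed (mconst c) = const c"
  by (simp add: embed_def mconst_def const_def)

definition pow_sum :: "nat \<Rightarrow> nat \<Rightarrow> nat \<Rightarrow> real_mpoly" where
  "pow_sum m n l = (\<Sum>i=1..m. (\<Sum>j=1..n. mvar (MatVar i j) * mvar (VecVar j)) ^ l)"

lemma embed_pow_sum: "embed (pow_sum m n l) = power_sum_Ax m n l"
  by (simp add: pow_sum_def power_sum_Ax_def embed_sum embed_power embed_mult embed_mvar)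

lemma pow_sum_vec_span: "pow_sum m n l \<in> vec_span m n l"
  unfolding pow_sum_def
proof (intro vec_span_sum vec_span_power)
  fix i j assume "i \<in> {1..m}" "j \<in> {1..n}"
  then show "mvar (MatVar i j) * mvar (VecVar j) \<in> vec_span m n 1"
    using vec_span_mult[OF vec_span_mat_polys[OF mat_polys_var[of i m j n], where d = 0] vec_span_VecVar]
    by simp
qed

lemma mat_polys_field_F:
  assumes "c \<in> mat_polys m n"
  shows "embed c \<in> field_F m n k"
  using assms
proof induction
  case (mat_polys_var i j)
  then have "Var (MatVar i j) \<in> matrix_vars m n" by (auto simp: matrix_vars_def)
  then show ?case
    unfolding embed_mvar field_F_def by (intro real_adjoin_incl) auto
qed (auto simp: field_F_def embed_mconst embed_add embed_mult
      intro: real_adjoin_const real_adjoin_add real_adjoin_mult)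

text \<open>A \<open>wpoly\<close> is only a function, so its construction is replayed on actual
  polynomials. Weight turns into degree in \<open>x\<close>, because \<open>pow_sum m n l\<close>
  has degree at most \<open>l\<close>.\<close>

lemma wpoly_lift:
  assumes "wpoly {1..k} w f"
  shows "\<exists>g. g \<in> vec_span m n w \<and> embed g \<in> field_F m n k \<and>
    (\<forall>a. mpoly_val a g = f (\<lambda>l. mpoly_val a (pow_sum m n l)))"
  using assms
proof (induction rule: wpoly.induct)
  case (wpoly_const w c)
  show ?case
    by (intro exI[of _ "mconst c"])
       (simp add: vec_span_mat_polys mat_polys_const mat_polys_field_F)
next
  case (wpoly_var l w)
  have "power_sum_Ax m n l \<in> field_F m n k"
    unfolding field_F_def using wpoly_var by (intro real_adjoin_incl) auto
  then show ?case
    using wpoly_var by (intro exI[of _ "pow_sum m n l"])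
      (simp add: embed_pow_sum vec_span_mono[OF pow_sum_vec_span])
next
  case (wpoly_add w f1 f2)
  then obtain g1 g2 where
    "g1 \<in> vec_span m n w" "embed g1 \<in> field_F m n k" "\<forall>a. mpoly_val a g1 = f1 (\<lambda>l. mpoly_val a (pow_sum m n l))"
    "g2 \<in> vec_span m n w" "embed g2 \<in> field_F m n k" "\<forall>a. mpoly_val a g2 = f2 (\<lambda>l. mpoly_val a (pow_sum m n l))"
    by blast
  then show ?case
    by (intro exI[of _ "g1 + g2"])
       (auto simp: vec_span_add embed_add field_F_def intro: real_adjoin_add)
next
  case (wpoly_mult w f1 v f2)
  then obtain g1 g2 where
    "g1 \<in> vec_span m n w" "embed g1 \<in> field_F m n k" "\<forall>a. mpoly_val a g1 = f1 (\<lambda>l. mpoly_val a (pow_sum m n l))"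
    "g2 \<in> vec_span m n v" "embed g2 \<in> field_F m n k" "\<forall>a. mpoly_val a g2 = f2 (\<lambda>l. mpoly_val a (pow_sum m n l))"
    by blast
  then show ?case
    by (intro exI[of _ "g1 * g2"])
       (auto simp: vec_span_mult embed_mult field_F_def intro: real_adjoin_mult)
qed

text \<open>Needed because power sums are matched at positive indices only: at index 0 they count
  \<open>m\<close> rows on one side and \<open>n + 1\<close> coordinates on the other.\<close>

lemma wpoly_cong:
  assumes "wpoly V w f" "\<And>l. l \<in> V \<Longrightarrow> P l = P' l"
  shows "f P = f P'"
  using assms by induction auto

section \<open>Specialisation to the hyperplane\<close>

text \<open>Parametrises the hyperplane by solving its equation for the coordinate 0, whose
  coefficient is 1.\<close>

definition hyperplane_coord :: "nat \<Rightarrow> (nat \<Rightarrow> real) \<Rightarrow> nat \<Rightarrow> real" where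
  "hyperplane_coord n x i = (if i = 0 then - (\<Sum>j=1..n. real (Suc j) * x j) else x i)"

lemma weighted_sum_hyperplane_coord: "weighted_sum n (hyperplane_coord n x) = 0"
  by (simp add: weighted_sum_def hyperplane_coord_def atMost_atLeast0 sum.atLeast_Suc_atMost)

text \<open>Row \<open>i\<close> of this matrix computes the coordinate with index \<open>i - 1\<close>.\<close>

definition hyperplane_matrix :: "nat \<Rightarrow> nat \<Rightarrow> nat \<Rightarrow> real" where
  "hyperplane_matrix n i j =
    (if i = 1 then - real (Suc j) else if i \<le> Suc n \<and> i = Suc j then 1 else 0)"

lemma hyperplane_matrix_mult:
  assumes "1 \<le> i"
  shows "(\<Sum>j=1..n. hyperplane_matrix n i j * x j) =
    (if i \<le> Suc n then hyperplane_coord n x (i - 1) else 0)"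
proof (cases "i = 1")
  case True
  then show ?thesis
    by (simp add: hyperplane_matrix_def hyperplane_coord_def sum_negf[symmetric] del: of_nat_Suc)
next
  case False
  have "(\<Sum>j=1..n. hyperplane_matrix n i j * x j) =
      (\<Sum>j=1..n. if j = i - 1 then (if i \<le> Suc n then x (i - 1) else 0) else 0)"
    using False assms by (intro sum.cong) (auto simp: hyperplane_matrix_def)
  then show ?thesis
    using False assms by (auto simp: hyperplane_coord_def)
qed

text \<open>There are at least \<open>n + 1\<close> rows, and each later one contributes
  \<open>0 ^ l\<close>, which is zero for positive \<open>l\<close>.\<close>

lemma pow_sum_hyperplane:
  assumes "m > n" "l \<ge> 1"
  shows "mpoly_val (point (hyperplane_matrix n) x) (pow_sum m n l) = psum {..n} (hyperplane_coord n x) l"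
proof -
  have "mpoly_val (point (hyperplane_matrix n) x) (pow_sum m n l) =
      (\<Sum>i=1..m. (\<Sum>j=1..n. hyperplane_matrix n i j * x j) ^ l)"
    by (simp add: pow_sum_def)
  also have "\<dots> = (\<Sum>i=1..m. (if i \<le> Suc n then hyperplane_coord n x (i - 1) else 0) ^ l)"
  proof (intro sum.cong refl)
    fix i assume "i \<in> {1..m}"
    then have "1 \<le> i" by simp
    from hyperplane_matrix_mult[OF this]
    show "(\<Sum>j=1..n. hyperplane_matrix n i j * x j) ^ l =
        (if i \<le> Suc n then hyperplane_coord n x (i - 1) else 0) ^ l"
      by (rule arg_cong)
  qed
  also have "\<dots> = (\<Sum>i=Suc 0..Suc n. hyperplane_coord n x (i - 1) ^ l)"
    using assms by (intro sum.mono_neutral_cong_right) (auto simp: zero_power)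
  also have "\<dots> = psum {..n} (hyperplane_coord n x) l"
    unfolding sum.shift_bounds_cl_Suc_ivl by (simp add: psum_def atMost_atLeast0)
  finally show ?thesis .
qed

text \<open>A linear form vanishing on the hyperplane is a multiple of
  \<open>weighted_sum n\<close>. Here its coefficients are a permutation of those of
  \<open>weighted_sum n\<close>, and the bound on the last one forces the multiplier
  \<open>Suc (s 0)\<close> to be 1.\<close>

lemma permutation_preserving_weighted_sum_eq_id:
  assumes "\<tau> permutes {..n}"
    and zero: "\<And>x. weighted_sum n (hyperplane_coord n x \<circ> \<tau>) = 0"
  shows "\<tau> = id"
proof -
  define s where "s = inv_into UNIV \<tau>"
  have s: "s permutes {..n}" "\<And>i. \<tau> (s i) = i"
    using permutes_inv[OF assms(1)] permutes_inverses[OF assms(1)] by (auto simp: s_def)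
  have reindex: "weighted_sum n (y \<circ> \<tau>) = (\<Sum>i\<le>n. real (Suc (s i)) * y i)" for y
    unfolding weighted_sum_def
    using sum.permute[OF s(1), of "\<lambda>i. real (Suc i) * (y \<circ> \<tau>) i"] by (simp add: o_def s(2))
  have s_eq: "Suc (s k) = Suc k * Suc (s 0)" if k: "k \<in> {1..n}" for k
  proof -
    \<comment> \<open>At the \<open>k\<close>-th unit vector only the coordinates 0 and
      \<open>k\<close> survive.\<close>
    define x where "x j = (if j = k then 1 else 0 :: real)" for j
    have "(\<Sum>j=1..n. real (Suc j) * x j) = (\<Sum>j=1..n. if j = k then real (Suc k) else 0)"
      by (intro sum.cong) (auto simp: x_def)
    also have "\<dots> = real (Suc k)"
      using k by simp
    finally have "hyperplane_coord n x = (\<lambda>i. if i = 0 then - real (Suc k) else if i = k then 1 else 0)"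
      by (simp only: hyperplane_coord_def fun_eq_iff x_def) simp
    then have "0 = (\<Sum>i\<le>n. real (Suc (s i)) * (if i = 0 then - real (Suc k) else if i = k then 1 else 0))"
      using zero[of x] unfolding reindex by (simp only:)
    also have "\<dots> = (\<Sum>i\<le>n. (if i = 0 then - (real (Suc (s 0)) * real (Suc k)) else 0) +
        (if i = k then real (Suc (s k)) else 0))"
      using k by (intro sum.cong) (auto simp: algebra_simps)
    also have "\<dots> = real (Suc (s k)) - real (Suc (s 0)) * real (Suc k)"
      using k by (simp add: sum.distrib)
    finally have "real (Suc (s k)) = real (Suc k * Suc (s 0))"
      by (simp only: of_nat_mult) (simp add: mult.commute)
    then show ?thesis by (simp only: of_nat_eq_iff)
  qed
  have s0: "s 0 = 0"
  proof (cases "n = 0")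
    case True
    then show ?thesis using permutes_in_image[OF s(1), of 0] by simp
  next
    case False
    have "s n \<le> n" using permutes_in_image[OF s(1), of n] by simp
    then have "Suc n * Suc (s 0) \<le> Suc n * 1" using s_eq[of n] False by simp
    then show ?thesis by (simp only: mult_le_cancel1) simp
  qed
  have "s k = k" for k
    using s0 s_eq[of k] permutes_not_in[OF s(1), of k]
    by (cases "k = 0"; cases "k \<le> n") auto
  then have "\<tau> k = k" for k using s(2)[of k] by simp
  then show ?thesis by (simp add: fun_eq_iff)
qed

text \<open>A polynomial version of \<open>hyperplane_coord\<close>, so that the absence of zero
  divisors can be used.\<close>

definition hyperplane_mpoly :: "nat \<Rightarrow> nat \<Rightarrow> real_mpoly" where
  "hyperplane_mpoly n i = (if i = 0 then \<Sum>j=1..n. mconst (- real (Suc j)) * mvar (VecVar j)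
    else mvar (VecVar i))"

lemma hyperplane_mpoly_val:
  "mpoly_val a (hyperplane_mpoly n i) = hyperplane_coord n (\<lambda>j. a (VecVar j)) i"
  by (simp add: hyperplane_mpoly_def hyperplane_coord_def sum_negf[symmetric] del: of_nat_Suc)

text \<open>The product \<open>T\<close> is a nonzero polynomial because none of its factors
  vanishes identically. The given relation says that \<open>T * p\<close> vanishes at every point,
  hence \<open>p = 0\<close>.\<close>

lemma monomials_independent_times_conjugate_prod:
  assumes "finite B" "\<And>x. (\<Sum>\<mu>\<in>B. b \<mu> * (conjugate_prod n (hyperplane_coord n x) *
      monom_val (point A x) \<mu>)) = 0"
    and keys: "\<And>\<mu>. \<mu> \<in> B \<Longrightarrow> Poly_Mapping.keys \<mu> \<subseteq> range VecVar" and "\<mu> \<in> B"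
  shows "b \<mu> = 0"
proof -
  define L where "L \<tau> = (\<Sum>i\<le>n. mconst (real (Suc i)) * hyperplane_mpoly n (\<tau> i))" for \<tau> :: "nat \<Rightarrow> nat"
  have L: "mpoly_val a (L \<tau>) = weighted_sum n (hyperplane_coord n (\<lambda>j. a (VecVar j)) \<circ> \<tau>)" for a \<tau>
    by (simp add: L_def weighted_sum_def hyperplane_mpoly_val)
  define T where "T = (\<Prod>\<tau>\<in>{\<tau>. \<tau> permutes {..n}} - {id}. L \<tau>)"
  have T: "mpoly_val a T = conjugate_prod n (hyperplane_coord n (\<lambda>j. a (VecVar j)))" for a
    by (simp add: T_def L conjugate_prod_def)
  define p where "p = (\<Sum>\<mu>\<in>B. Poly_Mapping.single \<mu> (b \<mu>))"
  have "T \<noteq> 0"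
  proof
    assume "T = 0"
    then obtain \<tau> where \<tau>: "\<tau> permutes {..n}" "\<tau> \<noteq> id" "L \<tau> = 0"
      by (auto simp: T_def finite_permutations)
    have "weighted_sum n (hyperplane_coord n x \<circ> \<tau>) = 0" for x
      using L[of "point A x" \<tau>] \<tau>(3) by simp
    then show False
      using permutation_preserving_weighted_sum_eq_id \<tau> by blast
  qed
  have "mpoly_val a (T * p) = 0" for a
  proof -
    define x where "x j = a (VecVar j)" for j
    have "monom_val a \<mu> = monom_val (point A x) \<mu>" if "\<mu> \<in> B" for \<mu>
      unfolding monom_val_def using keys[OF that] by (intro prod.cong) (auto simp: x_def)
    then have "mpoly_val a (T * p) = (\<Sum>\<mu>\<in>B. b \<mu> * (conjugate_prod n (hyperplane_coord n x) *
        monom_val (point A x) \<mu>))"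
      by (simp add: T p_def x_def[symmetric] sum_distrib_left mult_ac)
    then show ?thesis using assms(2) by simp
  qed
  then have "T * p = 0" using mpoly_nonzero_val by blast
  then have "p = 0" using \<open>T \<noteq> 0\<close> by simp
  moreover have "Poly_Mapping.lookup p \<mu> = b \<mu>"
    using assms(1,4) by (simp add: p_def lookup_sum lookup_single when_def)
  ultimately show ?thesis by simp
qed

text \<open>Each \<open>G \<mu>\<close> is a polynomial in the power sums that specialises to
  \<open>\<mu>\<close> times the conjugate product. A nontrivial relation among the
  \<open>G \<mu>\<close> would specialise to a nontrivial real one among these multiples.\<close>

lemma power_sum_family:
  assumes "m > n"
  shows "\<exists>G. (\<forall>\<mu>\<in>vec_monoms n d.
      G \<mu> \<in> vec_span m n (d + card ({\<tau>. \<tau> permutes {..n}} - {id})) \<and>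
      embed (G \<mu>) \<in> field_F m n (n + 1)) \<and>
    (\<forall>c. (\<forall>\<mu>\<in>vec_monoms n d. c \<mu> \<in> mat_polys m n) \<longrightarrow> (\<Sum>\<mu>\<in>vec_monoms n d. c \<mu> * G \<mu>) = 0 \<longrightarrow>
      (\<forall>\<mu>\<in>vec_monoms n d. c \<mu> = 0))"
proof -
  let ?e = "card ({\<tau>. \<tau> permutes {..n}} - {id})"
  let ?p = "point (hyperplane_matrix n)"
  have "\<exists>g. g \<in> vec_span m n (d + ?e) \<and> embed g \<in> field_F m n (n + 1) \<and>
      (\<forall>x. mpoly_val (?p x) g = conjugate_prod n (hyperplane_coord n x) * monom_val (?p x) \<mu>)"
    if \<mu>: "\<mu> \<in> vec_monoms n d" for \<mu>
  proof -
    \<comment> \<open>Coordinate 0 depends on the others and gets exponent 0; coordinates 1 to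
      \<open>n\<close> are the \<open>x\<close> themselves.\<close>
    define \<gamma> where "\<gamma> i = (if i = 0 then 0 else Poly_Mapping.lookup \<mu> (VecVar i))" for i
    have deg: "(\<Sum>i\<le>n. \<gamma> i) \<le> d"
      using \<mu> by (simp add: \<gamma>_def vec_monoms_def atMost_atLeast0 sum.atLeast_Suc_atMost)
    from conjugate_prod_psum[of n \<gamma>]
    obtain f where f: "wpoly {1..Suc n} ((\<Sum>i\<le>n. \<gamma> i) + ?e) f"
      "\<forall>y. weighted_sum n y = 0 \<longrightarrow> f (psum {..n} y) = conjugate_prod n y * (\<Prod>i\<le>n. y i ^ \<gamma> i)"
      by (elim exE conjE)
    have f': "wpoly {1..n + 1} (d + ?e) f"
      using wpoly_mono[OF f(1), of "d + ?e"] deg by simp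
    from wpoly_lift[OF f', of m n]
    obtain g where g: "g \<in> vec_span m n (d + ?e)" "embed g \<in> field_F m n (n + 1)"
      "\<forall>a. mpoly_val a g = f (\<lambda>l. mpoly_val a (pow_sum m n l))"
      by (elim exE conjE)
    have "mpoly_val (?p x) g = conjugate_prod n (hyperplane_coord n x) * monom_val (?p x) \<mu>" for x
    proof -
      have "mpoly_val (?p x) g = f (psum {..n} (hyperplane_coord n x))"
        unfolding g(3)[rule_format]
        by (rule wpoly_cong[OF f']) (simp add: pow_sum_hyperplane[OF assms])
      also have "\<dots> = conjugate_prod n (hyperplane_coord n x) * (\<Prod>i\<le>n. hyperplane_coord n x i ^ \<gamma> i)"
        by (rule f(2)[rule_format, OF weighted_sum_hyperplane_coord])
      also have "(\<Prod>i\<le>n. hyperplane_coord n x i ^ \<gamma> i) =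
          (\<Prod>i=1..n. x i ^ Poly_Mapping.lookup \<mu> (VecVar i))"
        by (simp add: \<gamma>_def hyperplane_coord_def atMost_atLeast0 prod.atLeast_Suc_atMost)
      also have "\<dots> = monom_val (?p x) \<mu>"
        using \<mu> by (subst monom_val_superset[of "VecVar ` {1..n}"])
          (auto simp: vec_monoms_def prod.reindex inj_on_def)
      finally show ?thesis .
    qed
    then show ?thesis
      by (intro exI[of _ g] conjI g(1,2) allI)
  qed
  then have "\<exists>G. \<forall>\<mu>\<in>vec_monoms n d. G \<mu> \<in> vec_span m n (d + ?e) \<and> embed (G \<mu>) \<in> field_F m n (n + 1) \<and>
      (\<forall>x. mpoly_val (?p x) (G \<mu>) = conjugate_prod n (hyperplane_coord n x) * monom_val (?p x) \<mu>)"
    by (intro bchoice ballI)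
  then obtain G where G: "\<And>\<mu>. \<mu> \<in> vec_monoms n d \<Longrightarrow> G \<mu> \<in> vec_span m n (d + ?e)"
    "\<And>\<mu>. \<mu> \<in> vec_monoms n d \<Longrightarrow> embed (G \<mu>) \<in> field_F m n (n + 1)"
    "\<And>\<mu> x. \<mu> \<in> vec_monoms n d \<Longrightarrow>
      mpoly_val (?p x) (G \<mu>) = conjugate_prod n (hyperplane_coord n x) * monom_val (?p x) \<mu>"
    by blast
  have indep: "c \<nu> = 0" if c: "\<And>\<mu>. \<mu> \<in> vec_monoms n d \<Longrightarrow> c \<mu> \<in> mat_polys m n"
    "(\<Sum>\<mu>\<in>vec_monoms n d. c \<mu> * G \<mu>) = 0" and \<nu>: "\<nu> \<in> vec_monoms n d" for c \<nu>
  proof (rule ccontr)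
    assume "c \<nu> \<noteq> 0"
    from specialise_relation[OF finite_vec_monoms c \<nu> this, of "hyperplane_matrix n"]
    obtain b \<kappa> where b: "\<kappa> \<in> vec_monoms n d" "b \<kappa> \<noteq> 0"
      "\<And>x. (\<Sum>\<mu>\<in>vec_monoms n d. b \<mu> * mpoly_val (?p x) (G \<mu>)) = 0"
      by blast
    have "b \<kappa> = 0"
    proof (rule monomials_independent_times_conjugate_prod[of "vec_monoms n d" b n "hyperplane_matrix n"])
      show "(\<Sum>\<mu>\<in>vec_monoms n d. b \<mu> * (conjugate_prod n (hyperplane_coord n x) *
          monom_val (?p x) \<mu>)) = 0" for x
        using b(3)[of x] by (simp add: G(3))
      show "Poly_Mapping.keys \<mu> \<subseteq> range VecVar" if "\<mu> \<in> vec_monoms n d" for \<mu>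
        using that by (auto simp: vec_monoms_def)
    qed (use b(1) in simp_all)
    then show False using b(2) by simp
  qed
  show ?thesis
  proof (intro exI[of _ G] conjI ballI allI impI)
    show "c \<nu> = 0" if "\<forall>\<mu>\<in>vec_monoms n d. c \<mu> \<in> mat_polys m n"
      "(\<Sum>\<mu>\<in>vec_monoms n d. c \<mu> * G \<mu>) = 0" "\<nu> \<in> vec_monoms n d" for c \<nu>
      using that by (intro indep[of c \<nu>]) auto
  qed (use G in auto)
qed

section \<open>Dimension count and conclusion\<close>

lemma vec_span_dependency:
  assumes "finite I" "card (vec_monoms n d) < card I" "\<And>i. i \<in> I \<Longrightarrow> H i \<in> vec_span m n d"
  shows "\<exists>c. (\<forall>i\<in>I. c i \<in> mat_polys m n) \<and> (\<exists>i\<in>I. c i \<noteq> 0) \<and> (\<Sum>i\<in>I. c i * H i) = 0"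
proof -
  have "\<forall>i\<in>I. \<exists>Q. (\<forall>\<mu>. Q \<mu> \<in> mat_polys m n) \<and>
      H i = (\<Sum>\<mu>\<in>vec_monoms n d. Q \<mu> * Poly_Mapping.single \<mu> 1)"
    using vec_span_coefficients assms(3) by blast
  from bchoice[OF this]
  obtain Q where Q: "\<And>i \<mu>. i \<in> I \<Longrightarrow> Q i \<mu> \<in> mat_polys m n"
    "\<And>i. i \<in> I \<Longrightarrow> H i = (\<Sum>\<mu>\<in>vec_monoms n d. Q i \<mu> * Poly_Mapping.single \<mu> 1)"
    by blast
  have "\<exists>c. (\<forall>i\<in>I. c i \<in> mat_polys m n) \<and> (\<exists>i\<in>I. c i \<noteq> 0) \<and>
      (\<forall>\<mu>\<in>vec_monoms n d. (\<Sum>i\<in>I. c i * Q i \<mu>) = 0)"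
    by (intro fraction_free_dependency finite_vec_monoms assms(1,2) mat_polys_1 mat_polys_uminus
        mat_polys_add mat_polys_mult Q(1))
  then obtain c where c: "\<forall>i\<in>I. c i \<in> mat_polys m n" "\<exists>i\<in>I. c i \<noteq> 0"
    "\<forall>\<mu>\<in>vec_monoms n d. (\<Sum>i\<in>I. c i * Q i \<mu>) = 0"
    by blast
  have "(\<Sum>i\<in>I. c i * H i) = (\<Sum>i\<in>I. \<Sum>\<mu>\<in>vec_monoms n d. c i * Q i \<mu> * Poly_Mapping.single \<mu> 1)"
    by (intro sum.cong refl) (simp add: Q(2) sum_distrib_left mult.assoc)
  also have "\<dots> = (\<Sum>\<mu>\<in>vec_monoms n d. (\<Sum>i\<in>I. c i * Q i \<mu>) * Poly_Mapping.single \<mu> 1)"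
    by (subst sum.swap) (simp add: sum_distrib_right)
  also have "\<dots> = 0" using c(3) by simp
  finally show ?thesis using c(1,2) by blast
qed

text \<open>For suitable \<open>d\<close> the elements \<open>G \<mu>\<close> and their products
  with the variable outnumber the monomials of degree at most \<open>d + e + 1\<close>:
  \<open>e\<close> accounts for the conjugate product, 1 for the variable. The resulting relation is
  linear in the variable and is solved for it.\<close>

lemma VecVar_in_field_F:
  assumes "m > n" "j \<in> {1..n}"
  shows "Var (VecVar j) \<in> field_F m n (n + 1)"
proof -
  let ?F = "field_F m n (n + 1)"
  define e where "e = card ({\<tau>. \<tau> permutes {..n}} - {id})"
  have "card (vec_monoms n 0) > 0"
    using zero_in_vec_monoms by (auto simp: card_gt_0_iff)
  then obtain d where d: "card (vec_monoms n (d + (e + 1))) < 2 * card (vec_monoms n d)"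
    using polynomial_growth_not_doubling[of "\<lambda>d. card (vec_monoms n d)" n "e + 1"] card_vec_monoms_le
    by blast
  let ?B = "vec_monoms n d"
  obtain G where G: "\<And>\<mu>. \<mu> \<in> ?B \<Longrightarrow> G \<mu> \<in> vec_span m n (d + e)" "\<And>\<mu>. \<mu> \<in> ?B \<Longrightarrow> embed (G \<mu>) \<in> ?F"
    and indep: "\<And>c. (\<forall>\<mu>\<in>?B. c \<mu> \<in> mat_polys m n) \<Longrightarrow> (\<Sum>\<mu>\<in>?B. c \<mu> * G \<mu>) = 0 \<Longrightarrow> \<forall>\<mu>\<in>?B. c \<mu> = 0"
    using power_sum_family[OF assms(1), of d] unfolding e_def by auto
  \<comment> \<open>The boolean tag tells the multiples by the variable from the plain
    \<open>G \<mu>\<close>, so the index set has exactly twice the size of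
    \<open>?B\<close>.\<close>
  define H where "H i = (if snd i then mvar (VecVar j) * G (fst i) else G (fst i))" for i
  have H: "H i \<in> vec_span m n (d + (e + 1))" if "i \<in> ?B \<times> UNIV" for i
    using that vec_span_mult[OF vec_span_VecVar[OF assms(2)] G(1), of "fst i"]
      vec_span_mono[OF G(1), of "fst i" "d + (e + 1)"]
    by (auto simp: H_def add_ac)
  obtain c where c: "\<forall>i\<in>?B \<times> UNIV. c i \<in> mat_polys m n" "\<exists>i\<in>?B \<times> UNIV. c i \<noteq> 0"
    "(\<Sum>i\<in>?B \<times> (UNIV :: bool set). c i * H i) = 0"
    using vec_span_dependency[of "?B \<times> UNIV" n "d + (e + 1)" H m] H d
    by (auto simp: card_cartesian_product)
  define N where "N b = (\<Sum>\<mu>\<in>?B. c (\<mu>, b) * G \<mu>)" for b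
  have "(\<Sum>i\<in>?B \<times> (UNIV :: bool set). c i * H i) = N False + mvar (VecVar j) * N True"
  proof -
    have "(\<Sum>i\<in>?B \<times> (UNIV :: bool set). c i * H i) = (\<Sum>\<mu>\<in>?B. \<Sum>b\<in>UNIV. c (\<mu>, b) * H (\<mu>, b))"
      by (simp add: sum.cartesian_product)
    then show ?thesis
      by (simp add: N_def UNIV_bool H_def sum.distrib sum_distrib_left mult_ac add_ac)
  qed
  then have rel: "N False + mvar (VecVar j) * N True = 0" using c(3) by simp
  have NF: "embed (N b) \<in> ?F" for b
    unfolding N_def embed_sum embed_mult
    using c(1) G(2) mat_polys_field_F[of _ m n "n + 1"]
    by (auto simp: field_F_def intro!: real_adjoin_sum real_adjoin_mult)
  have N_zero: "\<forall>\<mu>\<in>?B. c (\<mu>, b) = 0" if "N b = 0" for b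
    using indep[of "\<lambda>\<mu>. c (\<mu>, b)"] c(1) that by (auto simp: N_def)
  \<comment> \<open>Otherwise \<open>N False\<close> vanishes as well, and independence of the
    \<open>G \<mu>\<close> kills all coefficients.\<close>
  have "N True \<noteq> 0"
  proof
    assume *: "N True = 0"
    then have "N False = 0" using rel by simp
    with * have "c (\<mu>, b) = 0" if "\<mu> \<in> ?B" for \<mu> b
      using N_zero that by (cases b) auto
    then show False using c(2) by auto
  qed
  then have nz: "embed (N True) \<noteq> 0" by (simp add: embed_0_iff)
  have "embed (N False) + Var (VecVar j) * embed (N True) = 0"
    using arg_cong[OF rel, of embed] embed_0_iff[of 0] by (simp add: embed_add embed_mult embed_mvar)
  then have "Var (VecVar j) = - embed (N False) * inverse (embed (N True))"
    using nz by (simp add: field_simps add_eq_0_iff)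
  then show ?thesis
    using NF by (simp add: field_F_def real_adjoin_mult real_adjoin_uminus real_adjoin_inverse
        del: mult_minus_left)
qed

theorem theorem1p2:
  fixes m n :: nat
  assumes "n \<ge> 1" and "m > n"
  shows "field_F m n (n + 1) = field_E m n"
proof
  have "power_sum_Ax m n l \<in> field_E m n" for l
    unfolding power_sum_Ax_def field_E_def
    by (intro real_adjoin_sum real_adjoin_power real_adjoin_mult real_adjoin_incl)
       (auto simp: matrix_vars_def vector_vars_def)
  then show "field_F m n (n + 1) \<subseteq> field_E m n"
    unfolding field_F_def field_E_def by (intro real_adjoin_subset) (auto intro: real_adjoin_incl)
  show "field_E m n \<subseteq> field_F m n (n + 1)"
    using VecVar_in_field_F[OF assms(2)]
    unfolding field_F_def field_E_def
    by (intro real_adjoin_subset) (auto simp: vector_vars_def intro: real_adjoin_incl)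
qed

end
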